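(* Let $f\in C_{\lambda}(\mathbb{S}^1)$ be a piecewise $C^2$ map with slope strictly greater than $1$. Then $f$ is transitive if and only if $(f,\mathbb{S}^1,\mathcal{B},\lambda)$ is ergodic.
   Context: The circle $\mathbb{S}^1$ is identified with $[0,1)$ (i.e. $\mathbb{R}/\mathbb{Z}$), $\lambda$ denotes normalized Lebesgue measure on $\mathbb{S}^1$ and $\mathcal{B}$ the Borel sets of $\mathbb{S}^1$. $C_{\lambda}(\mathbb{S}^1)$ is the set of all continuous maps $f:\mathbb{S}^1\to\mathbb{S}^1$ that preserve $\lambda$. Piecewise $C^2$ has its usual meaning: there is a finite partition of $\mathbb{S}^1$ into arcs such that the restriction of $f$ to the interior of each arc extends to a $C^2$ function on the closed arc. A piecewise monotone map $f$ has slope $>s$ if $\left|\frac{f(x)-f(y)}{x-y}\right|>s$ whenever $x\neq y$ are points of an arc of monotonicity of $f$ (differences being computed in a lifting of $f$ to $\mathbb{R}$). $f$ is transitive if for each pair of nonempty open sets $U,V\subset\mathbb{S}^1$ there is $n\ge0$ with $f^n(U)\cap V\ne\emptyset$. $(f,\mathbb{S}^1,\mathcal{B},\lambda)$ is ergodic if for each $A\in\mathcal{B}$, $f^{-1}(A)=A$ $\lambda$-a.e. implies $\lambda(A)=0$ or $\lambda(A^c)=0$. *)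

theory Defs
  imports "HOL-Analysis.Analysis"
begin

text \<open>The circle \<open>\<real>/\<int>\<close> is represented by its fundamental domain \<open>{0..<1}\<close>; the projection
  \<open>\<real> \<rightarrow> \<real>/\<int>\<close> is then \<^const>\<open>frac\<close>, and the topology is the quotient topology of this
  projection, not the subspace topology of \<open>{0..<1}\<close>.\<close>

definition circle :: "real topology" where
  "circle = topology (\<lambda>U. U \<subseteq> {0..<1} \<and> open (frac -` U))"

lemma openin_circle: "openin circle U \<longleftrightarrow> U \<subseteq> {0..<1} \<and> open (frac -` U)"
proof -
  have "istopology (\<lambda>U. U \<subseteq> {0..<1::real} \<and> open (frac -` U :: real set))"
    unfolding istopology_def by (auto simp: vimage_Union vimage_Int)
  then show ?thesis
    unfolding circle_def by (simp add: topology_inverse')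
qed

lemma topspace_circle: "topspace circle = {0..<1}"
proof
  show "topspace circle \<subseteq> {0..<1}"
    unfolding topspace_def openin_circle by blast
  have "frac -` {0..<1} = (UNIV :: real set)"
    by (auto simp: frac_lt_1)
  then have "openin circle {0..<1}"
    by (simp add: openin_circle)
  then show "{0..<1} \<subseteq> topspace circle"
    by (rule openin_subset)
qed

lemma quotient_map_frac: "quotient_map euclidean circle (frac :: real \<Rightarrow> real)"
proof -
  have "range (frac :: real \<Rightarrow> real) = {0..<1}"
  proof
    show "range (frac :: real \<Rightarrow> real) \<subseteq> {0..<1}" by (auto simp: frac_lt_1)
    have "x = frac x" if "x \<in> {0..<1}" for x :: real
      using that by (simp add: frac_eq)
    then show "{0..<1} \<subseteq> range (frac :: real \<Rightarrow> real)" by blast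
  qed
  then show ?thesis
    by (auto simp: quotient_map_def topspace_circle openin_circle vimage_def)
qed

definition circle_measure :: "real measure" where
  "circle_measure = restrict_space lborel {0..<1}"

lemma space_circle_measure: "space circle_measure = {0..<1}"
  by (simp add: circle_measure_def space_restrict_space)

lemma sets_circle_measure: "sets circle_measure = sigma_sets {0..<1} {U. openin circle U}"
proof
  let ?S = "sigma_sets {0..<1::real} {U. openin circle U}"
  interpret S: sigma_algebra "{0..<1::real}" ?S
    by (rule sigma_algebra_sigma_sets) (auto simp: openin_circle)
  have frac_id: "frac x = x" if "x \<in> {0..<1}" for x :: real
    using that by (simp add: frac_eq)
  have borel_eq: "sets circle_measure = sets (restrict_space borel {0..<1})"
    by (simp add: circle_measure_def sets_restrict_space)
  show "?S \<subseteq> sets circle_measure"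
  proof (rule sigma_algebra.sigma_sets_subset)
    show "sigma_algebra {0..<1} (sets circle_measure)"
      using sets.sigma_algebra_axioms[of circle_measure] by (simp add: space_circle_measure)
    show "{U. openin circle U} \<subseteq> sets circle_measure"
    proof
      fix U assume "U \<in> {U. openin circle U}"
      then have U: "U \<subseteq> {0..<1}" "open (frac -` U)" by (auto simp: openin_circle)
      then have "U = {0..<1} \<inter> frac -` U" using frac_id by auto
      then show "U \<in> sets circle_measure"
        unfolding borel_eq sets_restrict_space
        by (rule image_eqI) (rule borel_open[OF U(2)])
    qed
  qed
  have punctured: "openin circle (V \<inter> {0<..<1})" if "open V" for V :: "real set"
  proof -
    have "frac -` (V \<inter> {0<..<1}) = (\<Union>n::int. (\<lambda>x. x - of_int n) -` (V \<inter> {0<..<1}))"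
    proof (intro set_eqI iffI)
      fix x :: real assume "x \<in> frac -` (V \<inter> {0<..<1})"
      then show "x \<in> (\<Union>n::int. (\<lambda>x. x - of_int n) -` (V \<inter> {0<..<1}))"
        by (auto simp: frac_def intro!: exI[of _ "\<lfloor>x\<rfloor>"])
    next
      fix x :: real assume "x \<in> (\<Union>n::int. (\<lambda>x. x - of_int n) -` (V \<inter> {0<..<1}))"
      then obtain n :: int where n: "x - of_int n \<in> V \<inter> {0<..<1}" by auto
      then have "frac x = x - of_int n" by (simp add: frac_unique_iff)
      then show "x \<in> frac -` (V \<inter> {0<..<1})" using n by simp
    qed
    moreover have "open ((\<lambda>x. x - of_int n) -` (V \<inter> {0<..<1}))" for n :: int
      using that by (intro open_vimage continuous_intros) auto
    ultimately show ?thesis by (auto simp: openin_circle)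
  qed
  have "{0<..<1::real} \<in> ?S" using punctured[of UNIV] by (auto intro: sigma_sets.Basic)
  then have "{0..<1} - {0<..<1::real} \<in> ?S" by (rule S.compl_sets)
  moreover have "{0..<1} - {0<..<1::real} = {0}" by auto
  ultimately have zero: "{0::real} \<in> ?S" by simp
  have gen: "V \<inter> {0..<1} \<in> ?S" if "open V" for V :: "real set"
  proof -
    have "V \<inter> {0<..<1} \<in> ?S" using punctured[OF that] by (auto intro: sigma_sets.Basic)
    moreover have "V \<inter> {0::real} \<in> ?S" using zero by (cases "0 \<in> V") auto
    moreover have "V \<inter> {0..<1} = (V \<inter> {0<..<1}) \<union> (V \<inter> {0})" by auto
    ultimately show ?thesis by auto
  qed
  have "V \<inter> {0..<1} \<in> ?S" if "V \<in> sigma_sets UNIV {V::real set. open V}" for V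
    using that
  proof induction
    case (Basic a) then show ?case using gen by simp
  next
    case Empty then show ?case by simp
  next
    case (Compl a)
    have "(UNIV - a) \<inter> {0..<1} = {0..<1} - a \<inter> {0..<1}" by auto
    then show ?case using S.compl_sets[OF Compl.IH] by simp
  next
    case (Union a)
    have "(\<Union>i. a i \<inter> {0..<1}) \<in> ?S" by (rule sigma_sets.Union) (rule Union.IH)
    moreover have "\<Union> (range a) \<inter> {0..<1} = (\<Union>i. a i \<inter> {0..<1})" by auto
    ultimately show ?case by (simp only:)
  qed
  moreover have "sets (borel :: real measure) = sigma_sets UNIV {V. open V}"
    unfolding borel_def by (rule sets_measure_of) simp
  ultimately have "{0..<1} \<inter> V \<in> ?S" if "V \<in> sets borel" for V
    using that by (simp only: Int_commute)
  then show "sets circle_measure \<subseteq> ?S"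
    unfolding borel_eq sets_restrict_space by (rule image_subsetI)
qed

definition preserves :: "'a measure \<Rightarrow> ('a \<Rightarrow> 'a) \<Rightarrow> bool" where
  "preserves M f \<longleftrightarrow> f \<in> measurable M M \<and>
     (\<forall>A\<in>sets M. emeasure M (f -` A \<inter> space M) = emeasure M A)"

text \<open>Only the values of the maps on \<open>{0..<1}\<close> are meaningful.\<close>

definition C_lambda :: "(real \<Rightarrow> real) set" where
  "C_lambda = {f. continuous_map circle circle f \<and> preserves circle_measure f}"

definition lifting :: "(real \<Rightarrow> real) \<Rightarrow> (real \<Rightarrow> real) \<Rightarrow> bool" where
  "lifting f F \<longleftrightarrow> continuous_on UNIV F \<and> (\<forall>x. frac (F x) = f (frac x))"

text \<open>Cut points, in the universal cover, of a partition of the circle into the \<open>n\<close> arcs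
  with lifts \<open>[a i, a (Suc i)]\<close>, \<open>i < n\<close>.\<close>

definition arc_partition :: "nat \<Rightarrow> (nat \<Rightarrow> real) \<Rightarrow> bool" where
  "arc_partition n a \<longleftrightarrow> (\<forall>i<n. a i < a (Suc i)) \<and> a n = a 0 + 1"

text \<open>At the endpoints, the derivatives are one-sided.\<close>

definition C2_on :: "real set \<Rightarrow> (real \<Rightarrow> real) \<Rightarrow> bool" where
  "C2_on S g \<longleftrightarrow> (\<exists>g' g''.
     (\<forall>x\<in>S. (g has_real_derivative g' x) (at x within S)) \<and>
     (\<forall>x\<in>S. (g' has_real_derivative g'' x) (at x within S)) \<and>
     continuous_on S g'')"

definition piecewise_C2 :: "(real \<Rightarrow> real) \<Rightarrow> bool" where
  "piecewise_C2 f \<longleftrightarrow> (\<exists>F n a. lifting f F \<and> arc_partition n a \<and>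
     (\<forall>i<n. \<exists>g. C2_on {a i..a (Suc i)} g \<and> (\<forall>x\<in>{a i<..<a (Suc i)}. g x = F x)))"

definition monotone_map_on :: "real set \<Rightarrow> (real \<Rightarrow> real) \<Rightarrow> bool" where
  "monotone_map_on S F \<longleftrightarrow> mono_on S F \<or> antimono_on S F"

definition piecewise_monotone :: "(real \<Rightarrow> real) \<Rightarrow> bool" where
  "piecewise_monotone f \<longleftrightarrow> (\<exists>F n a. lifting f F \<and> arc_partition n a \<and>
     (\<forall>i<n. monotone_map_on {a i..a (Suc i)} F))"

text \<open>An arc of the circle is the injective image under \<^const>\<open>frac\<close> of an interval of the
  universal cover. Liftings of a continuous map differ by integer constants only, so the choice
  of \<open>F\<close> here and above is immaterial.\<close>

definition slope_gt :: "real \<Rightarrow> (real \<Rightarrow> real) \<Rightarrow> bool" where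
  "slope_gt s f \<longleftrightarrow> piecewise_monotone f \<and>
     (\<exists>F. lifting f F \<and>
       (\<forall>J. is_interval J \<and> inj_on frac J \<and> monotone_map_on J F \<longrightarrow>
         (\<forall>x\<in>J. \<forall>y\<in>J. x \<noteq> y \<longrightarrow> \<bar>(F x - F y) / (x - y)\<bar> > s)))"

definition transitive :: "'a topology \<Rightarrow> ('a \<Rightarrow> 'a) \<Rightarrow> bool" where
  "transitive X f \<longleftrightarrow> (\<forall>U V. openin X U \<and> U \<noteq> {} \<and> openin X V \<and> V \<noteq> {} \<longrightarrow>
     (\<exists>n. (f ^^ n) ` U \<inter> V \<noteq> {}))"

definition ergodic :: "'a measure \<Rightarrow> ('a \<Rightarrow> 'a) \<Rightarrow> bool" where
  "ergodic M f \<longleftrightarrow> (\<forall>A\<in>sets M. (AE x in M. x \<in> f -` A \<longleftrightarrow> x \<in> A) \<longrightarrow>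
     emeasure M A = 0 \<or> emeasure M (space M - A) = 0)"

end

theory Submission
  imports Defs
begin

text \<open>
Ergodicity gives transitivity because the points whose orbit meets an open set \<open>V\<close> form a set that
contains its own preimage; by invariance of the measure the two agree up to a null set, so this set has
full measure and meets every open set \<open>U\<close>.

For the converse it suffices that an invariant set \<open>A\<close> of positive measure contains a nonempty open
set modulo null sets (\<open>invariant_set_contains_open\<close>). Applied to \<open>A\<close> and to its complement this yields
two open sets \<open>J\<close> and \<open>J'\<close>; transitivity provides a nonempty open set of points of \<open>J\<close> that some iterate
sends into \<open>J'\<close>, and almost none of them can exist.

To find the open set, cut the circle at finitely many points so that each resulting branch of \<open>f\<close> is
\<open>C\<^sup>2\<close> and is mapped onto a whole component of the complement of a finite set \<open>V\<close>
(\<open>full_branch_structure\<close>). A slope above \<open>1\<close> alone does not bound the expansion away from \<open>1\<close>, since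
the derivative might equal \<open>1\<close> at single points, but invariance of Lebesgue measure does: an interval
\<open>J\<close> in the image of a branch must have a second preimage, whose length is at least that of \<open>J\<close> divided
by the Lipschitz constant, and this leaves at most a fixed proportion of the length of \<open>J\<close> for the
first (\<open>uniform_expansion\<close>).

Now suppose that \<open>A\<close> contains no open set. Cut the circle into short intervals of length \<open>\<rho>\<close>; the
complement of \<open>A\<close> occupies a positive proportion of each. Pull these intervals back along the branches
again and again, dropping those that meet \<open>V\<close>. Because lengths decay geometrically, the dropped
intervals have total measure at most a constant times \<open>\<rho>\<close>; because \<open>f\<close> preserves the measure, this is
also a bound on what the pulled back intervals fail to cover at any later time; and because \<open>f'\<close> is
Lipschitz on each branch, the distortions multiply up to a bounded factor
(\<open>complement_packing_pullback\<close>, \<open>complement_packing_iterate\<close>). So there are arbitrarily fine families of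
disjoint intervals that cover all but a small part of the circle and in each of which the complement of
\<open>A\<close> keeps a fixed proportion. This contradicts the regularity of Lebesgue measure: a fine enough family
has members that stay in a small neighbourhood of a compact subset of \<open>A\<close>.
\<close>

section \<open>Lebesgue measure on the circle\<close>

lemma sets_circle_measure_iff: "A \<in> sets circle_measure \<longleftrightarrow> A \<in> sets borel \<and> A \<subseteq> {0..<1}"
  by (auto simp: circle_measure_def sets_restrict_space_iff)

lemma emeasure_circle_measure:
  "A \<subseteq> {0..<1} \<Longrightarrow> emeasure circle_measure A = emeasure lborel A"
  by (simp add: circle_measure_def emeasure_restrict_space)

lemma measure_circle_measure:
  "A \<subseteq> {0..<1} \<Longrightarrow> measure circle_measure A = measure lborel A"
  by (simp add: measure_def emeasure_circle_measure)

interpretation circle: finite_measure circle_measure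
  by standard (simp add: emeasure_circle_measure space_circle_measure)

lemma measure_circle_finite:
  assumes "finite A" "A \<subseteq> {0..<1}"
  shows "measure circle_measure A = 0"
  using assms finite_imp_null_set_lborel[of A]
  by (simp add: measure_circle_measure measure_eq_0_null_sets)

lemma circle_open_measure_pos:
  assumes "open A" "A \<subseteq> {0..<1}" "A \<noteq> {}"
  shows "0 < measure circle_measure A"
proof -
  have "emeasure lborel A \<noteq> 0"
    using assms(1,3) open_not_negligible by (metis negligible_iff_null_sets null_setsI null_sets_completionI sets_lborel borel_open)
  moreover have "emeasure circle_measure A = measure circle_measure A"
    by (rule circle.emeasure_eq_measure)
  ultimately show ?thesis
    using assms(2) by (simp add: emeasure_circle_measure zero_less_measure_iff)
qed

lemma openin_circle_open:
  assumes "open A" "A \<subseteq> {0<..<1}"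
  shows "openin circle A"
proof -
  have "frac -` A = (\<Union>n::int. (\<lambda>x. x - of_int n) -` A)"
  proof (intro set_eqI iffI)
    fix x :: real assume "x \<in> frac -` A"
    then show "x \<in> (\<Union>n::int. (\<lambda>x. x - of_int n) -` A)"
      by (auto simp: frac_def intro!: exI[of _ "\<lfloor>x\<rfloor>"])
  next
    fix x :: real assume "x \<in> (\<Union>n::int. (\<lambda>x. x - of_int n) -` A)"
    then obtain n :: int where n: "x - of_int n \<in> A" by auto
    moreover then have "x - of_int n \<in> {0<..<1}" using assms(2) by blast
    ultimately have "frac x = x - of_int n" by (simp add: frac_unique_iff)
    then show "x \<in> frac -` A" using n by simp
  qed
  moreover have "open ((\<lambda>x. x - of_int n) -` A)" for n :: int
    using assms(1) by (intro open_vimage continuous_intros) auto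
  ultimately show ?thesis
    using assms(2) by (auto simp: openin_circle)
qed

text \<open>A neighbourhood of \<open>0\<close> on the circle need not be open on the line. Discarding \<open>0\<close> leaves a set that
is, and it stays nonempty because no point of the circle is isolated.\<close>

lemma openin_circle_interior:
  assumes "openin circle U" "U \<noteq> {}"
  shows "open (U \<inter> {0<..<1})" "U \<inter> {0<..<1} \<noteq> {}"
proof -
  have U: "U \<subseteq> {0..<1}" "open (frac -` U)" using assms by (auto simp: openin_circle)
  have eq: "U \<inter> {0<..<1} = frac -` U \<inter> {0<..<1}"
    by (auto simp: frac_eq[THEN iffD2])
  show "open (U \<inter> {0<..<1})" unfolding eq using U by (intro open_Int) auto
  obtain x where x: "x \<in> U" using assms by auto
  then have "frac x = x" using U by (auto simp: frac_eq)
  then have "x \<in> frac -` U" using x by simp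
  then obtain e where e: "e > 0" "ball x e \<subseteq> frac -` U" using U open_contains_ball by metis
  \<comment> \<open>a step to the right of \<open>x\<close>, short enough to stay in the ball and below \<open>1\<close>\<close>
  define y where "y = x + min (e/2) ((1 - x)/2)"
  have xs: "0 \<le> x" "x < 1" using x U by auto
  have "y \<in> ball x e" "y \<in> {0<..<1}"
    using xs e(1) by (auto simp: y_def dist_real_def min_def field_simps)
  then have "y \<in> frac -` U \<inter> {0<..<1}" using e by blast
  then show "U \<inter> {0<..<1} \<noteq> {}" using eq by auto
qed

text \<open>Change of variables: the measure of \<open>f ` S\<close> is the integral of \<open>\<bar>h\<bar>\<close> over \<open>S\<close>.\<close>

lemma measure_image_bounds:
  fixes f h :: "real \<Rightarrow> real"
  assumes S: "S \<in> sets circle_measure" and fS: "f ` S \<in> sets circle_measure"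
    and der: "\<And>x. x \<in> S \<Longrightarrow> (f has_real_derivative h x) (at x)"
    and inj: "inj_on f S"
    and bd: "\<And>x. x \<in> S \<Longrightarrow> l \<le> \<bar>h x\<bar> \<and> \<bar>h x\<bar> \<le> L"
  shows "l * measure circle_measure S \<le> measure circle_measure (f ` S)"
    and "measure circle_measure (f ` S) \<le> L * measure circle_measure S"
proof -
  have lm: "A \<in> lmeasurable \<and> measure circle_measure A = integral A (\<lambda>x. 1::real)"
    if A: "A \<in> sets circle_measure" for A
  proof -
    have b: "A \<in> sets borel" "A \<subseteq> {0..<1}" using A by (auto simp: sets_circle_measure_iff)
    have "emeasure lborel A \<noteq> \<infinity>"
      using circle.emeasure_finite[of A] b(2) by (simp add: emeasure_circle_measure)
    then have "A \<in> lmeasurable"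
      using b by (auto simp: fmeasurable_def top.not_eq_extremum sets_completionI_sets)
    then show ?thesis
      using b by (simp add: measure_circle_measure flip: lmeasure_integral measure_completion)
  qed
  let ?b = "integral (f ` S) (\<lambda>x. 1::real)"
  have "(\<lambda>x. 1::real) absolutely_integrable_on (f ` S)"
    using lm[OF fS] by (simp add: absolutely_integrable_on_const)
  then have cv: "(\<lambda>x. \<bar>h x\<bar> * 1) absolutely_integrable_on S"
    and cv2: "integral S (\<lambda>x. \<bar>h x\<bar> * 1) = ?b"
    using has_absolute_integral_change_of_variables_1'[of S f h "\<lambda>x. 1" ?b] lm[OF S] der inj
    by (auto intro: has_field_derivative_at_within)
  have io: "(\<lambda>x. \<bar>h x\<bar>) integrable_on S"
    using set_lebesgue_integral_eq_integral(1)[OF cv] by simp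
  have ic: "(\<lambda>x. c) integrable_on S" for c :: real
    using lm[OF S] integrable_on_const by auto
  have cc: "integral S (\<lambda>x. c) = c * measure circle_measure S" for c :: real
    using lm[OF S] integral_mult_right[of S c "\<lambda>x. 1"] by simp
  show "l * measure circle_measure S \<le> measure circle_measure (f ` S)"
    using integral_le[OF ic[of l] io] bd cv2 lm[OF fS] cc[of l] by simp
  show "measure circle_measure (f ` S) \<le> L * measure circle_measure S"
    using integral_le[OF io ic[of L]] bd cv2 lm[OF fS] cc[of L] by simp
qed

section \<open>Expanding maps with full branches\<close>

text \<open>A measure-preserving circle map, seen as a real function on the disjoint open intervals in \<open>\<B>\<close>.
No branch takes a value in the finite set \<open>V\<close>, and \<open>branch_full\<close> says that the image of a branch is a
whole component of the complement of \<open>V\<close>: an interval that avoids \<open>V\<close> lies inside this image or is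
disjoint from it, so its preimage in the branch is either empty or a complete copy of it.\<close>

locale full_branch_map =
  fixes f h :: "real \<Rightarrow> real" and \<B> :: "real set set" and V :: "real set" and C M :: real
  assumes preserving: "preserves circle_measure f"
    and finite_branches: "finite \<B>"
    and finite_V: "finite V"
    and disjoint_branches: "disjoint \<B>"
    and branch_open: "U \<in> \<B> \<Longrightarrow> open U"
    and branch_convex: "U \<in> \<B> \<Longrightarrow> convex U"
    and branch_circle: "U \<in> \<B> \<Longrightarrow> U \<subseteq> {0..<1}"
    and branches_cover: "finite ({0..<1} - \<Union>\<B>)"
    and deriv: "\<lbrakk>U \<in> \<B>; x \<in> U\<rbrakk> \<Longrightarrow> (f has_real_derivative h x) (at x)"
    and deriv_bound: "\<lbrakk>U \<in> \<B>; x \<in> U\<rbrakk> \<Longrightarrow> \<bar>h x\<bar> \<le> C"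
    and deriv_lipschitz: "\<lbrakk>U \<in> \<B>; x \<in> U; y \<in> U\<rbrakk> \<Longrightarrow> \<bar>h x - h y\<bar> \<le> M * \<bar>x - y\<bar>"
    and slope: "\<lbrakk>U \<in> \<B>; x \<in> U; y \<in> U; x \<noteq> y\<rbrakk> \<Longrightarrow> \<bar>x - y\<bar> < \<bar>f x - f y\<bar>"
    and branch_avoids: "\<lbrakk>U \<in> \<B>; x \<in> U\<rbrakk> \<Longrightarrow> f x \<notin> V"
    and branch_full: "\<lbrakk>U \<in> \<B>; convex I; I \<subseteq> {0..<1}; I \<inter> V = {}; I \<inter> f ` U \<noteq> {}\<rbrakk> \<Longrightarrow> I \<subseteq> f ` U"
    and C_ge: "2 \<le> C" and M_nonneg: "0 \<le> M"
begin

abbreviation \<mu> :: "real set \<Rightarrow> real" where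
  "\<mu> \<equiv> measure circle_measure"

lemma vimage_sets: "A \<in> sets circle_measure \<Longrightarrow> f -` A \<inter> {0..<1} \<in> sets circle_measure"
  using preserving measurable_sets[of f circle_measure circle_measure A]
  by (simp add: preserves_def space_circle_measure)

lemma vimage_measure: "A \<in> sets circle_measure \<Longrightarrow> \<mu> (f -` A \<inter> {0..<1}) = \<mu> A"
  using preserving by (simp add: preserves_def space_circle_measure measure_def)

lemma f_circle: "x \<in> {0..<1} \<Longrightarrow> f x \<in> {0..<1}"
  using preserving measurable_space[of f circle_measure circle_measure x]
  by (simp add: preserves_def space_circle_measure)

lemma branch_inj: "U \<in> \<B> \<Longrightarrow> inj_on f U"
proof (rule inj_onI)
  fix x y assume "U \<in> \<B>" "x \<in> U" "y \<in> U" "f x = f y"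
  then show "x = y" using slope[of U x y] by (cases "x = y") auto
qed

lemma branch_continuous: "U \<in> \<B> \<Longrightarrow> continuous_on U f"
  by (meson DERIV_isCont continuous_at_imp_continuous_on deriv)

lemma branch_sets: "U \<in> \<B> \<Longrightarrow> U \<in> sets circle_measure"
  using branch_open branch_circle by (auto simp: sets_circle_measure_iff)

text \<open>A continuous injective function on an interval is monotone.\<close>

lemma branch_between:
  assumes "U \<in> \<B>" "x \<in> U" "y \<in> U" "x < z" "z < y"
  shows "z \<in> U" "(f x < f z \<and> f z < f y) \<or> (f y < f z \<and> f z < f x)"
proof -
  have sub: "{x..y} \<subseteq> U"
    using branch_convex[OF assms(1)] assms(2,3)
    using closed_segment_subset[of x U y] assms(4,5) by (simp add: closed_segment_eq_real_ivl)
  then show "z \<in> U" using assms by auto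
  have "continuous_on {x..y} f" "inj_on f {x..y}"
    using branch_continuous branch_inj assms sub continuous_on_subset inj_on_subset by blast+
  then show "(f x < f z \<and> f z < f y) \<or> (f y < f z \<and> f z < f x)"
    using continuous_inj_imp_mono[of x z y f] assms by auto
qed

lemma measure_eq_sum_branches:
  assumes A: "A \<in> sets circle_measure"
  shows "\<mu> A = (\<Sum>U\<in>\<B>. \<mu> (A \<inter> U))"
proof -
  have "A \<subseteq> {0..<1}" using A by (simp add: sets_circle_measure_iff)
  then have eq: "A = (\<Union>U\<in>\<B>. A \<inter> U) \<union> (A - \<Union>\<B>)" and fin: "finite (A - \<Union>\<B>)"
    using finite_subset[OF _ branches_cover, of "A - \<Union>\<B>"] by auto
  have s: "(\<Union>U\<in>\<B>. A \<inter> U) \<in> sets circle_measure"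
    using finite_branches branch_sets A by auto
  have "\<Union>\<B> \<in> sets circle_measure"
    using finite_branches branch_sets by (intro sets.finite_Union) auto
  then have n: "A - \<Union>\<B> \<in> sets circle_measure" using A by auto
  have "\<mu> A = \<mu> ((\<Union>U\<in>\<B>. A \<inter> U) \<union> (A - \<Union>\<B>))" using eq by simp
  also have "\<dots> = \<mu> (\<Union>U\<in>\<B>. A \<inter> U) + \<mu> (A - \<Union>\<B>)"
    by (rule circle.finite_measure_Union) (use s n in auto)
  also have "\<mu> (A - \<Union>\<B>) = 0"
    using fin \<open>A \<subseteq> {0..<1}\<close> by (intro measure_circle_finite) auto
  also have "\<mu> (\<Union>U\<in>\<B>. A \<inter> U) = (\<Sum>U\<in>\<B>. \<mu> (A \<inter> U))"
    using A branch_sets disjoint_branches finite_branches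
    by (intro circle.finite_measure_finite_Union)
       (auto simp: disjoint_family_on_def disjoint_def)
  finally show ?thesis by simp
qed

text \<open>Let \<open>J\<close> be the image of \<open>[x, y]\<close>. The preimage of \<open>J\<close> has the measure of \<open>J\<close>, which exceeds \<open>y - x\<close> because
of the slope; so some other branch also meets \<open>J\<close>, and then covers it. As derivatives are at most
\<open>C\<close>, the preimage of \<open>J\<close> in that branch takes up at least the proportion \<open>1 / C\<close> of the measure of \<open>J\<close>.\<close>

lemma uniform_expansion:
  assumes U: "U \<in> \<B>" "x \<in> U" "y \<in> U"
  shows "\<bar>x - y\<bar> \<le> (1 - 1 / C) * \<bar>f x - f y\<bar>"
proof -
  have main: "y - x \<le> (1 - 1 / C) * \<bar>f x - f y\<bar>" if U: "U \<in> \<B>" "x \<in> U" "y \<in> U" and xy: "x < y" for x y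
  proof -
    define J where "J = closed_segment (f x) (f y)"
    have sub: "{x..y} \<subseteq> U"
    proof
      fix z assume "z \<in> {x..y}"
      then show "z \<in> U"
        using branch_between(1)[OF U, of z] U by (cases "z = x \<or> z = y") auto
    qed
    have fJ: "f ` {x..y} = J"
    proof
      show "f ` {x..y} \<subseteq> J"
      proof
        fix w assume "w \<in> f ` {x..y}"
        then obtain z where z: "w = f z" "x \<le> z" "z \<le> y" by auto
        then show "w \<in> J"
          using branch_between(2)[OF U, of z]
          by (cases "z = x \<or> z = y") (auto simp: J_def closed_segment_eq_real_ivl)
      qed
      have "connected (f ` {x..y})"
        by (rule connected_continuous_image[OF continuous_on_subset[OF branch_continuous[OF U(1)] sub]]) simp
      then have "convex (f ` {x..y})" using is_interval_connected_1 is_interval_convex_1 by blast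
      moreover have "f x \<in> f ` {x..y}" "f y \<in> f ` {x..y}" using xy by auto
      ultimately show "J \<subseteq> f ` {x..y}" unfolding J_def by (intro closed_segment_subset)
    qed
    have Jc: "J \<subseteq> {0..<1}"
      using fJ sub branch_circle[OF U(1)] f_circle by blast
    have Js: "J \<in> sets circle_measure"
      using Jc by (auto simp: sets_circle_measure_iff J_def closed_segment_eq_real_ivl)
    have JV: "J \<inter> V = {}"
      using branch_avoids[OF U(1)] sub fJ by blast
    have Jm: "\<mu> J = \<bar>f x - f y\<bar>"
      using Jc by (simp add: measure_circle_measure) (auto simp: J_def closed_segment_eq_real_ivl)
    have Im: "\<mu> {x..y} = y - x"
      using sub branch_circle[OF U(1)] xy by (subst measure_circle_measure) auto
    let ?P = "f -` J \<inter> {0..<1}"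
    have Ps: "?P \<in> sets circle_measure" and Pm: "\<mu> ?P = \<mu> J"
      using vimage_sets vimage_measure Js by auto
    have PU: "?P \<inter> U = {x..y}"
    proof
      show "?P \<inter> U \<subseteq> {x..y}"
      proof
        fix z assume "z \<in> ?P \<inter> U"
        then have "f z \<in> f ` {x..y}" "z \<in> U" using fJ by auto
        then show "z \<in> {x..y}"
          using inj_on_image_mem_iff[OF branch_inj[OF U(1)] _ sub] by blast
      qed
      show "{x..y} \<subseteq> ?P \<inter> U" using fJ sub branch_circle[OF U(1)] by blast
    qed
    show ?thesis
    \<comment> \<open>either a second branch covers \<open>J\<close>, or \<open>[x, y]\<close> is the whole preimage up to a null set\<close>
    proof (cases "\<exists>W\<in>\<B>. W \<noteq> U \<and> J \<inter> f ` W \<noteq> {}")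
      case True
      then obtain W where W: "W \<in> \<B>" "W \<noteq> U" "J \<inter> f ` W \<noteq> {}" by auto
      then have "J \<subseteq> f ` W"
        using branch_full[OF W(1) _ Jc JV] by (simp add: J_def convex_closed_segment)
      then have im: "f ` (?P \<inter> W) = J" using branch_circle[OF W(1)] by blast
      have "\<mu> (f ` (?P \<inter> W)) \<le> C * \<mu> (?P \<inter> W)"
        using W Ps Js im branch_sets deriv deriv_bound
        by (intro measure_image_bounds(2)[where h = h and l = 0])
           (auto intro: inj_on_subset[OF branch_inj])
      moreover have "\<mu> (?P \<inter> U) + \<mu> (?P \<inter> W) \<le> \<mu> ?P"
      proof -
        have "U \<inter> W = {}" using W U disjoint_branches by (auto simp: disjoint_def)
        then have "\<mu> (?P \<inter> U) + \<mu> (?P \<inter> W) = \<mu> ((?P \<inter> U) \<union> (?P \<inter> W))"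
          using Ps W U branch_sets by (intro circle.finite_measure_Union[symmetric]) auto
        also have "\<dots> \<le> \<mu> ?P" using Ps by (intro circle.finite_measure_mono) auto
        finally show ?thesis .
      qed
      moreover have "\<mu> J / C \<le> \<mu> (?P \<inter> W)"
        using calculation(1) C_ge by (simp add: im pos_divide_le_eq mult.commute)
      ultimately have "y - x + \<mu> J / C \<le> \<mu> J"
        unfolding PU Im Pm by linarith
      then show ?thesis using Jm by (simp add: algebra_simps)
    next
      case False
      then have "\<mu> (?P \<inter> W) = (if W = U then y - x else 0)" if "W \<in> \<B>" for W
      proof (cases "W = U")
        case True then show ?thesis using PU Im by simp
      next
        case F: False
        then have "?P \<inter> W = {}" using False that by auto
        then show ?thesis using F by simp
      qed
      then have "\<mu> ?P = y - x"
        using measure_eq_sum_branches[OF Ps] U(1) finite_branches by simp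
      then have False using Pm Jm slope[OF U] xy by simp
      then show ?thesis ..
    qed
  qed
  show ?thesis
  proof (cases x y rule: linorder_cases)
    case less then show ?thesis using main[OF U] by simp
  next
    case equal then show ?thesis by simp
  next
    case greater then show ?thesis using main[OF U(1,3,2)] by (simp add: abs_minus_commute)
  qed
qed

lemma deriv_ge_1:
  assumes U: "U \<in> \<B>" "x \<in> U"
  shows "1 \<le> \<bar>h x\<bar>"
proof -
  have "((\<lambda>y. (f y - f x) / (y - x)) \<longlongrightarrow> h x) (at x)"
    using deriv[OF U] by (simp add: has_field_derivative_iff)
  then have "((\<lambda>y. \<bar>(f y - f x) / (y - x)\<bar>) \<longlongrightarrow> \<bar>h x\<bar>) (at x)"
    by (rule tendsto_rabs)
  moreover have "\<forall>\<^sub>F y in at x. 1 \<le> \<bar>(f y - f x) / (y - x)\<bar>"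
  proof -
    have "\<forall>\<^sub>F y in at x. y \<in> U"
      using branch_open[OF U(1)] U(2) by (rule eventually_at_in_open')
    moreover have "\<forall>\<^sub>F y in at x. y \<noteq> x" by (simp add: eventually_at_filter)
    ultimately show ?thesis
      by eventually_elim (use slope[OF U(1) _ U(2)] in \<open>force simp: abs_divide pos_le_divide_eq order_less_imp_le\<close>)
  qed
  ultimately show ?thesis by (rule tendsto_lowerbound) auto
qed

subsection \<open>Bounded distortion\<close>

definition \<sigma> :: real where "\<sigma> = C / (C - 1)"

lemma \<sigma>_gt_1: "1 < \<sigma>"
  using C_ge by (simp add: \<sigma>_def)

lemma branch_expands:
  assumes "U \<in> \<B>" "x \<in> U" "y \<in> U"
  shows "\<bar>x - y\<bar> \<le> \<bar>f x - f y\<bar> / \<sigma>"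
  using uniform_expansion[OF assms] C_ge by (simp add: \<sigma>_def field_simps)

lemma convex_vimage_branch:
  assumes U: "U \<in> \<B>" and I: "convex I"
  shows "convex (U \<inter> f -` I)"
proof -
  have "z \<in> U \<inter> f -` I" if "x \<in> U \<inter> f -` I" "y \<in> U \<inter> f -` I" "x \<le> z" "z \<le> y" for x y z
  proof (cases "z = x \<or> z = y")
    case False
    then have "x < z" "z < y" using that by auto
    note b = branch_between[OF U _ _ this]
    have "f z \<in> I"
      using b(2) that I unfolding is_interval_convex_1[symmetric] is_interval_1
      by (metis IntD1 IntD2 order_less_imp_le vimageE)
    then show ?thesis using b(1) that by auto
  qed (use that in auto)
  then show ?thesis unfolding is_interval_convex_1[symmetric] is_interval_1 by blast
qed

text \<open>The derivative varies along the preimage of \<open>I\<close> by a factor of at most \<open>1 + M * \<rho>\<close> in either direction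
from its value at a reference point. Comparing the measures of \<open>B\<close> and of \<open>I\<close> with those of their
preimages costs this factor once each, whence the square.\<close>

lemma branch_distortion:
  assumes U: "U \<in> \<B>" and I: "I \<in> sets circle_measure" "I \<subseteq> f ` U"
    and diam: "\<And>x y. x \<in> I \<Longrightarrow> y \<in> I \<Longrightarrow> \<bar>x - y\<bar> \<le> \<rho>"
    and B: "B \<in> sets circle_measure" "B \<subseteq> I"
    and c: "c * \<mu> I \<le> \<mu> B" "0 \<le> c"
  shows "c / (1 + M * \<rho>)\<^sup>2 * \<mu> (U \<inter> f -` I) \<le> \<mu> (U \<inter> f -` B)"
proof (cases "I = {}")
  case True then show ?thesis using B by simp
next
  case False
  then obtain x0 where x0: "x0 \<in> U" "f x0 \<in> I" using I by blast
  let ?k = "1 + M * \<rho>" and ?s = "\<bar>h x0\<bar>"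
  have "0 \<le> \<rho>" using diam[OF x0(2) x0(2)] by simp
  then have k: "0 < ?k" using M_nonneg by (simp add: add_pos_nonneg)
  have bd: "?s / ?k \<le> \<bar>h x\<bar> \<and> \<bar>h x\<bar> \<le> ?s * ?k" if x: "x \<in> U" "f x \<in> I" for x
  proof -
    have "\<bar>x - x0\<bar> \<le> \<bar>f x - f x0\<bar>"
      using slope[OF U x(1) x0(1)] by (cases "x = x0") auto
    also have "\<dots> \<le> \<rho>" using diam[OF x(2) x0(2)] .
    finally have "M * \<bar>x - x0\<bar> \<le> M * \<rho>" using M_nonneg by (rule mult_left_mono)
    then have d: "\<bar>h x - h x0\<bar> \<le> M * \<rho>" using deriv_lipschitz[OF U x(1) x0(1)] by linarith
    \<comment> \<open>as derivatives are at least \<open>1\<close>, the additive bound is also a multiplicative one\<close>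
    have "M * \<rho> \<le> M * \<rho> * t" if "1 \<le> t" for t
      using mult_left_mono[OF that, of "M * \<rho>"] M_nonneg \<open>0 \<le> \<rho>\<close> by simp
    from this[OF deriv_ge_1[OF U x(1)]] this[OF deriv_ge_1[OF U x0(1)]]
    have "?s \<le> \<bar>h x\<bar> * ?k" "\<bar>h x\<bar> \<le> ?s * ?k"
      using d by (simp_all add: algebra_simps)
    then show ?thesis using k by (simp add: pos_divide_le_eq)
  qed
  have im: "f ` (U \<inter> f -` A) = A" if "A \<subseteq> I" for A using that I by blast
  have ms: "U \<inter> f -` A \<in> sets circle_measure" if "A \<in> sets circle_measure" for A
  proof -
    have "U \<inter> f -` A = U \<inter> (f -` A \<inter> {0..<1})" using branch_circle[OF U] by auto
    then show ?thesis using vimage_sets[OF that] branch_sets[OF U] by auto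
  qed
  have inj: "inj_on f (U \<inter> f -` A)" for A using branch_inj[OF U] by (rule inj_on_subset) auto
  have "?s / ?k * \<mu> (U \<inter> f -` I) \<le> \<mu> (f ` (U \<inter> f -` I))"
    by (rule measure_image_bounds(1)[where h = h and L = "?s * ?k"])
       (use ms[OF I(1)] im[of I] I deriv[OF U] bd inj in auto)
  then have 1: "?s / ?k * \<mu> (U \<inter> f -` I) \<le> \<mu> I" by (simp only: im[OF subset_refl])
  have "\<mu> (f ` (U \<inter> f -` B)) \<le> ?s * ?k * \<mu> (U \<inter> f -` B)"
    by (rule measure_image_bounds(2)[where h = h and l = "?s / ?k"])
       (use ms[OF B(1)] im[of B] B deriv[OF U] bd inj in auto)
  then have 2: "\<mu> B \<le> ?s * ?k * \<mu> (U \<inter> f -` B)" by (simp only: im[OF B(2)])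
  have "c * (?s / ?k * \<mu> (U \<inter> f -` I)) \<le> c * \<mu> I"
    using 1 c(2) by (rule mult_left_mono)
  also have "\<dots> \<le> ?s * ?k * \<mu> (U \<inter> f -` B)" using c(1) 2 by linarith
  finally have "?s * (c / ?k * \<mu> (U \<inter> f -` I)) \<le> ?s * (?k * \<mu> (U \<inter> f -` B))"
    by (simp add: mult.assoc mult.left_commute)
  moreover have "0 < ?s" using deriv_ge_1[OF U x0(1)] by linarith
  ultimately have "c / ?k * \<mu> (U \<inter> f -` I) \<le> ?k * \<mu> (U \<inter> f -` B)"
    by (simp only: mult_le_cancel_left_pos)
  then have "c / ?k * \<mu> (U \<inter> f -` I) / ?k \<le> \<mu> (U \<inter> f -` B)"
    using k by (simp only: pos_divide_le_eq mult.commute)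
  then show ?thesis by (simp add: power2_eq_square)
qed

subsection \<open>Pulling back packings by intervals\<close>

text \<open>Finitely many disjoint intervals that fill the circle up to measure \<open>q\<close>, in each of which the
complement of \<open>A\<close> has proportion at least \<open>c\<close>. The parameters track how \<open>c\<close> and \<open>q\<close> degrade while the
mesh \<open>\<rho>\<close> shrinks under pullback.\<close>

definition complement_packing :: "real set \<Rightarrow> real \<Rightarrow> real \<Rightarrow> real \<Rightarrow> real set set \<Rightarrow> bool" where
  "complement_packing A c \<rho> q \<I> \<longleftrightarrow> finite \<I> \<and> disjoint \<I> \<and>
     (\<forall>I\<in>\<I>. open I \<and> convex I \<and> I \<subseteq> {0..<1} \<and> (\<forall>x\<in>I. \<forall>y\<in>I. \<bar>x - y\<bar> \<le> \<rho>) \<and>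
        c * \<mu> I \<le> \<mu> (I - A)) \<and>
     1 - q \<le> \<mu> (\<Union>\<I>)"

text \<open>The members that meet \<open>V\<close> are dropped; they lie within distance \<open>\<rho>\<close> of \<open>V\<close>, so the measure lost is at
most \<open>2 * \<rho>\<close> for each point of \<open>V\<close>. Every other member is covered completely by the branches that it
meets, so that its preimages are intervals again, with controlled distortion. Nothing else is lost,
since \<open>f\<close> preserves the measure, and the complement of \<open>A\<close> is its own preimage up to a null set.\<close>

lemma complement_packing_pullback:
  fixes c \<rho> q :: real
  assumes A: "A \<in> sets circle_measure"
    and inv: "AE x in circle_measure. x \<in> f -` A \<longleftrightarrow> x \<in> A"
    and good: "complement_packing A c \<rho> q \<I>" and c: "0 \<le> c" and \<rho>: "0 \<le> \<rho>"
  shows "\<exists>\<J>. complement_packing A (c / (1 + M * \<rho>)\<^sup>2) (\<rho> / \<sigma>) (q + 2 * card V * \<rho>) \<J>"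
proof -
  define \<G> where "\<G> = {I\<in>\<I>. I \<inter> V = {}}"
  define \<J> where "\<J> = (\<lambda>(U, I). U \<inter> f -` I) ` (\<B> \<times> \<G>)"
  have fin: "finite \<I>" and dis: "disjoint \<I>" and tot: "1 - q \<le> \<mu> (\<Union>\<I>)"
    and I: "\<And>I. I \<in> \<I> \<Longrightarrow> open I" "\<And>I. I \<in> \<I> \<Longrightarrow> convex I" "\<And>I. I \<in> \<I> \<Longrightarrow> I \<subseteq> {0..<1}"
      "\<And>I (x::real) y. I \<in> \<I> \<Longrightarrow> x \<in> I \<Longrightarrow> y \<in> I \<Longrightarrow> \<bar>x - y\<bar> \<le> \<rho>"
      "\<And>I. I \<in> \<I> \<Longrightarrow> c * \<mu> I \<le> \<mu> (I - A)"
    using good by (auto simp: complement_packing_def)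
  have Is: "I \<in> sets circle_measure" if "I \<in> \<I>" for I
    using I(1,3)[OF that] by (simp add: sets_circle_measure_iff)
  have \<G>\<I>: "\<G> \<subseteq> \<I>" by (auto simp: \<G>_def)
  have \<J>_elem: "open J \<and> convex J \<and> J \<subseteq> {0..<1} \<and> (\<forall>x\<in>J. \<forall>y\<in>J. \<bar>x - y\<bar> \<le> \<rho> / \<sigma>) \<and>
        c / (1 + M * \<rho>)\<^sup>2 * \<mu> J \<le> \<mu> (J - A)" if "J \<in> \<J>" for J
  proof -
    from that obtain U I where UI: "U \<in> \<B>" "I \<in> \<I>" "I \<inter> V = {}" and J: "J = U \<inter> f -` I"
      by (auto simp: \<J>_def \<G>_def)
    have "open J" unfolding J
      by (intro continuous_open_preimage branch_continuous branch_open UI I)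
    moreover have "convex J" unfolding J by (intro convex_vimage_branch UI I)
    moreover have Jc: "J \<subseteq> {0..<1}" using J branch_circle[OF UI(1)] by auto
    moreover have "\<bar>x - y\<bar> \<le> \<rho> / \<sigma>" if "x \<in> J" "y \<in> J" for x y
    proof -
      have "\<bar>x - y\<bar> \<le> \<bar>f x - f y\<bar> / \<sigma>" using that J UI by (intro branch_expands) auto
      also have "\<dots> \<le> \<rho> / \<sigma>" using that J UI I(4) \<sigma>_gt_1 by (intro divide_right_mono) auto
      finally show ?thesis .
    qed
    moreover have "c / (1 + M * \<rho>)\<^sup>2 * \<mu> J \<le> \<mu> (J - A)"
    proof (cases "J = {}")
      case True then show ?thesis by simp
    next
      case False
      then have full: "I \<subseteq> f ` U"
        using J branch_full[OF UI(1) I(2)[OF UI(2)] I(3)[OF UI(2)] UI(3)] by auto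
      have Js: "J \<in> sets circle_measure"
        using \<open>open J\<close> Jc by (simp add: sets_circle_measure_iff)
      have Bs: "I - A \<in> sets circle_measure" using Is[OF UI(2)] A by auto
      have "c / (1 + M * \<rho>)\<^sup>2 * \<mu> J \<le> \<mu> (U \<inter> f -` (I - A))"
        unfolding J
        by (rule branch_distortion[OF UI(1) Is[OF UI(2)] full I(4)[OF UI(2)] Bs _ I(5)[OF UI(2)] c]) auto
      also have "U \<inter> f -` (I - A) = J - f -` A" using J by auto
      also have "\<mu> (J - f -` A) = \<mu> (J - A)"
      proof (rule measure_eq_AE)
        show "AE x in circle_measure. x \<in> J - f -` A \<longleftrightarrow> x \<in> J - A" using inv by eventually_elim auto
        have "J - f -` A = J - (f -` A \<inter> {0..<1})" using Jc by auto
        then show "J - f -` A \<in> sets circle_measure" using Js vimage_sets[OF A] by auto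
        show "J - A \<in> sets circle_measure" using Js A by auto
      qed
      finally show ?thesis .
    qed
    ultimately show ?thesis by blast
  qed
  have "finite \<J>" using fin finite_branches \<G>\<I> by (auto simp: \<J>_def intro: finite_subset)
  moreover have "disjoint \<J>"
  proof (rule disjointI)
    fix J J' assume JJ: "J \<in> \<J>" "J' \<in> \<J>" "J \<noteq> J'"
    have "\<exists>U I. U \<in> \<B> \<and> I \<in> \<I> \<and> K = U \<inter> f -` I" if "K \<in> \<J>" for K
      using that \<G>\<I> by (auto simp: \<J>_def)
    with JJ obtain U I U' I' where *: "U \<in> \<B>" "U' \<in> \<B>" "I \<in> \<I>" "I' \<in> \<I>"
      "J = U \<inter> f -` I" "J' = U' \<inter> f -` I'" by metis
    show "J \<inter> J' = {}"
    proof (cases "U = U'")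
      case True
      then have "I \<inter> I' = {}" using * JJ dis by (auto simp: disjoint_def)
      then show ?thesis using * by auto
    next
      case False
      then have "U \<inter> U' = {}" using * disjoint_branches by (auto simp: disjoint_def)
      then show ?thesis using * by auto
    qed
  qed
  moreover have "1 - (q + 2 * card V * \<rho>) \<le> \<mu> (\<Union>\<J>)"
  proof -
    have Gs: "\<Union>\<G> \<in> sets circle_measure"
      using fin Is \<G>\<I> by (intro sets.finite_Union) (auto intro: finite_subset)
    let ?N = "\<lambda>v. {v - \<rho>..v + \<rho>} \<inter> {0..<1}"
    have Ns: "?N v \<in> sets circle_measure" for v by (simp add: sets_circle_measure_iff)
    have Nm: "\<mu> (?N v) \<le> 2 * \<rho>" for v
    proof -
      have "\<mu> (?N v) = measure lborel (?N v)" by (intro measure_circle_measure) auto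
      also have "\<dots> \<le> measure lborel {v - \<rho>..v + \<rho>}"
        by (intro measure_mono_fmeasurable fmeasurableI) (auto simp: emeasure_lborel_Icc_eq)
      finally show ?thesis using \<rho> by simp
    qed
    have UNs: "(\<Union>v\<in>V. ?N v) \<in> sets circle_measure"
      using Ns finite_V by (intro sets.finite_UN)
    have "\<Union>\<I> \<subseteq> \<Union>\<G> \<union> (\<Union>v\<in>V. ?N v)"
    proof
      fix x assume "x \<in> \<Union>\<I>"
      then obtain K where K: "K \<in> \<I>" "x \<in> K" by auto
      show "x \<in> \<Union>\<G> \<union> (\<Union>v\<in>V. ?N v)"
      proof (cases "K \<inter> V = {}")
        case True then show ?thesis using K by (auto simp: \<G>_def)
      next
        case False
        then obtain v where "v \<in> K" "v \<in> V" by auto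
        then show ?thesis using I(3)[OF K(1)] I(4)[OF K(1), of x v] K by force
      qed
    qed
    then have "\<mu> (\<Union>\<I>) \<le> \<mu> (\<Union>\<G> \<union> (\<Union>v\<in>V. ?N v))"
      using sets.Un[OF Gs UNs] by (rule circle.finite_measure_mono)
    also have "\<dots> \<le> \<mu> (\<Union>\<G>) + \<mu> (\<Union>v\<in>V. ?N v)"
      using Gs UNs by (rule measure_Un_le)
    also have "\<mu> (\<Union>v\<in>V. ?N v) \<le> (\<Sum>v\<in>V. \<mu> (?N v))"
      using finite_V Ns by (rule measure_UNION_le)
    also have "\<dots> \<le> (\<Sum>v\<in>V. 2 * \<rho>)" by (rule sum_mono) (rule Nm)
    also have "\<mu> (\<Union>\<G>) = \<mu> (f -` \<Union>\<G> \<inter> {0..<1})" using vimage_measure[OF Gs] by simp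
    also have "\<dots> = (\<Sum>U\<in>\<B>. \<mu> (f -` \<Union>\<G> \<inter> {0..<1} \<inter> U))"
      by (rule measure_eq_sum_branches[OF vimage_sets[OF Gs]])
    also have "\<dots> = (\<Sum>U\<in>\<B>. \<mu> (\<Union>\<J> \<inter> U))"
    proof (rule sum.cong[OF refl])
      fix U assume U: "U \<in> \<B>"
      have "f -` \<Union>\<G> \<inter> {0..<1} \<inter> U = \<Union>\<J> \<inter> U"
        using U branch_circle by (fastforce simp: \<J>_def)
      then show "\<mu> (f -` \<Union>\<G> \<inter> {0..<1} \<inter> U) = \<mu> (\<Union>\<J> \<inter> U)" by simp
    qed
    also have "\<dots> = \<mu> (\<Union>\<J>)"
    proof (rule measure_eq_sum_branches[symmetric])
      have "\<Union>\<J> \<in> sets borel" using \<J>_elem by (intro borel_open open_Union) auto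
      then show "\<Union>\<J> \<in> sets circle_measure" using \<J>_elem by (auto simp: sets_circle_measure_iff)
    qed
    finally show ?thesis using tot by (simp add: mult.commute mult.left_commute)
  qed
  ultimately have "complement_packing A (c / (1 + M * \<rho>)\<^sup>2) (\<rho> / \<sigma>) (q + 2 * card V * \<rho>) \<J>"
    using \<J>_elem by (auto simp: complement_packing_def)
  then show ?thesis ..
qed

text \<open>The mesh of the \<open>n\<close>-th pullback is \<open>\<rho> / \<sigma> ^ n\<close>, and both the measure lost and the logarithm of the
distortion are controlled by the sum of the meshes so far. This geometric sum equals
\<open>C * (\<rho> - \<rho> / \<sigma> ^ n)\<close>, because \<open>\<sigma> = C / (C - 1)\<close> makes the sum telescope: see \<open>rs\<close> below.\<close>

lemma complement_packing_iterate:
  fixes c \<rho> :: real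
  assumes A: "A \<in> sets circle_measure"
    and inv: "AE x in circle_measure. x \<in> f -` A \<longleftrightarrow> x \<in> A"
    and good: "complement_packing A c \<rho> 0 \<I>" and c: "0 \<le> c" and \<rho>: "0 \<le> \<rho>"
  shows "\<exists>\<J>. complement_packing A (c * exp (- (2 * M * C * (\<rho> - \<rho> / \<sigma> ^ n)))) (\<rho> / \<sigma> ^ n)
           (2 * card V * C * (\<rho> - \<rho> / \<sigma> ^ n)) \<J>"
proof (induction n)
  case 0
  then show ?case using good by auto
next
  case (Suc n)
  define r where "r = \<rho> / \<sigma> ^ n"
  define d where "d = c * exp (- (2 * M * C * (\<rho> - r)))"
  define q where "q = 2 * card V * C * (\<rho> - r)"
  from Suc.IH obtain \<K> where K: "complement_packing A d r q \<K>" by (auto simp: r_def d_def q_def)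
  have r: "0 \<le> r" using \<rho> \<sigma>_gt_1 by (simp add: r_def)
  have d: "0 \<le> d" using c by (simp add: d_def)
  from complement_packing_pullback[OF A inv K d r] obtain \<J>
    where J: "complement_packing A (d / (1 + M * r)\<^sup>2) (r / \<sigma>) (q + 2 * card V * r) \<J>" ..
  have rs: "C * (r - r / \<sigma>) = r" using C_ge by (simp add: \<sigma>_def field_simps)
  have r': "r / \<sigma> = \<rho> / \<sigma> ^ Suc n" by (simp add: r_def)
  have q': "q + 2 * card V * r = 2 * card V * C * (\<rho> - r / \<sigma>)"
  proof -
    have "q + 2 * card V * r = 2 * card V * C * (\<rho> - r) + 2 * card V * (C * (r - r / \<sigma>))"
      unfolding rs by (simp add: q_def)
    then show ?thesis by (simp add: algebra_simps)
  qed
  have "c * exp (- (2 * M * C * (\<rho> - r / \<sigma>))) = d / (exp (M * r))\<^sup>2"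
  proof -
    have "2 * M * C * (\<rho> - r / \<sigma>) = 2 * M * C * (\<rho> - r) + 2 * M * (C * (r - r / \<sigma>))"
      by (simp add: algebra_simps)
    also have "\<dots> = 2 * M * C * (\<rho> - r) + (M * r + M * r)" by (simp only: rs)
    finally have "exp (- (2 * M * C * (\<rho> - r / \<sigma>))) =
        inverse (exp (2 * M * C * (\<rho> - r)) * (exp (M * r) * exp (M * r)))"
      by (simp only: exp_minus exp_add)
    then show ?thesis
      by (simp add: d_def exp_minus power2_eq_square divide_inverse)
  qed
  also have "\<dots> \<le> d / (1 + M * r)\<^sup>2"
  proof (rule divide_left_mono)
    have "0 < 1 + M * r" using r M_nonneg by (simp add: add_pos_nonneg)
    then show "(1 + M * r)\<^sup>2 \<le> (exp (M * r))\<^sup>2" "0 < (exp (M * r))\<^sup>2 * (1 + M * r)\<^sup>2"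
      by (simp_all add: power_mono)
  qed (rule d)
  finally have le: "c * exp (- (2 * M * C * (\<rho> - r / \<sigma>))) \<le> d / (1 + M * r)\<^sup>2" .
  have "complement_packing A (c * exp (- (2 * M * C * (\<rho> - r / \<sigma>)))) (r / \<sigma>)
      (2 * card V * C * (\<rho> - r / \<sigma>)) \<J>"
    using J mult_right_mono[OF le, OF measure_nonneg] unfolding complement_packing_def q'
    by (meson order_trans)
  then show ?case unfolding r' by blast
qed

text \<open>Start from the grid of intervals of length \<open>1 / N\<close>. The bounds of the iteration converge, so \<open>c\<close> stays
away from \<open>0\<close>, and the total loss is proportional to \<open>1 / N\<close>, hence below \<open>q\<close> for \<open>N\<close> large. The value of
\<open>c\<close> depends on the grid, but not on \<open>n\<close>.\<close>

lemma uniform_complement_packings: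
  fixes q :: real
  assumes A: "A \<in> sets circle_measure"
    and inv: "AE x in circle_measure. x \<in> f -` A \<longleftrightarrow> x \<in> A"
    and pos: "\<And>J. open J \<Longrightarrow> J \<noteq> {} \<Longrightarrow> J \<subseteq> {0<..<1} \<Longrightarrow> 0 < \<mu> (J - A)"
    and q: "0 < q"
  obtains c \<rho> where "0 < c" "0 < \<rho>" "\<And>n. \<exists>\<J>. complement_packing A c (\<rho> / \<sigma> ^ n) q \<J>"
proof -
  obtain k where k: "2 * card V * C / q < real k" using reals_Archimedean2 by blast
  define N where "N = Suc k"
  have N: "0 < real N" "2 * card V * C / q \<le> real N" using k by (auto simp: N_def)
  define J where "J j = {real j / N<..<(real j + 1) / N}" for j :: nat
  have J01: "J j \<subseteq> {0<..<1}" if "j < N" for j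
  proof -
    have l: "0 \<le> real j / N" and u: "(real j + 1) / N \<le> 1" using that by auto
    show ?thesis
    proof
      fix x assume "x \<in> J j"
      then have "real j / N < x" "x < (real j + 1) / N" by (simp_all add: J_def)
      then have "0 < x" "x < 1" using l u by linarith+
      then show "x \<in> {0<..<1}" by simp
    qed
  qed
  have lt: "real j / N < (real j + 1) / N" for j :: nat
    using N by (intro divide_strict_right_mono) auto
  have Jne: "J j \<noteq> {}" for j unfolding J_def greaterThanLessThan_empty_iff not_le by (rule lt)
  have Js: "J j \<in> sets circle_measure" if "j < N" for j
    using J01[OF that] by (auto simp: sets_circle_measure_iff J_def)
  have Jm: "\<mu> (J j) = 1 / N" if "j < N" for j
  proof -
    have "\<mu> (J j) = measure lborel (J j)"
      using J01[OF that] by (intro measure_circle_measure) auto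
    also have "\<dots> = (real j + 1) / N - real j / N"
      unfolding J_def using lt[of j] by (intro measure_lborel_Ioo) auto
    also have "\<dots> = 1 / N" by (simp add: add_divide_distrib)
    finally show ?thesis .
  qed
  have Jd: "J i \<inter> J j = {}" if "i \<noteq> j" for i j
  proof -
    have *: "J i \<inter> J j = {}" if "i < j" for i j :: nat
    proof -
      have "(real i + 1) / N \<le> real j / N" using that N by (intro divide_right_mono) auto
      then show ?thesis by (auto simp: J_def)
    qed
    show ?thesis using *[of i j] *[of j i] that by (cases i j rule: linorder_cases) auto
  qed
  \<comment> \<open>a bound on the measures also bounds the proportions, as no interval is longer than \<open>1\<close>\<close>
  define c where "c = Min ((\<lambda>j. \<mu> (J j - A)) ` {..<N})"
  have ne: "(\<lambda>j. \<mu> (J j - A)) ` {..<N} \<noteq> {}" by (auto simp: N_def)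
  have c_pos: "0 < c"
    using pos[OF _ Jne J01] by (simp add: c_def Min_gr_iff[OF _ ne]) (simp add: J_def)
  have c_le: "c \<le> \<mu> (J j - A)" if "j < N" for j using that by (simp add: c_def)
  define \<rho> where "\<rho> = 1 / real N"
  have \<rho>: "0 < \<rho>" using N by (simp add: \<rho>_def)
  have good: "complement_packing A c \<rho> 0 (J ` {..<N})"
    unfolding complement_packing_def
  proof (intro conjI ballI)
    show "disjoint (J ` {..<N})" using Jd by (intro disjointI) (metis imageE)
    have "\<mu> (\<Union>j\<in>{..<N}. J j) = (\<Sum>j<N. \<mu> (J j))"
      using Js Jd by (intro circle.finite_measure_finite_Union) (auto simp: disjoint_family_on_def)
    also have "\<dots> = 1" using Jm N by simp
    finally show "1 - 0 \<le> \<mu> (\<Union> (J ` {..<N}))" by simp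
  next
    fix I assume "I \<in> J ` {..<N}"
    then obtain j where j: "j < N" "I = J j" by auto
    show "open I" "convex I" using j by (simp_all add: J_def)
    show "I \<subseteq> {0..<1}" using J01[OF j(1)] j by auto
    show "\<bar>x - y\<bar> \<le> \<rho>" if "x \<in> I" "y \<in> I" for x y
    proof -
      have "(real j + 1) / N - real j / N = \<rho>" by (simp add: \<rho>_def add_divide_distrib)
      moreover have "real j / N < x" "x < (real j + 1) / N" "real j / N < y" "y < (real j + 1) / N"
        using that by (simp_all add: j J_def)
      ultimately show ?thesis unfolding abs_le_iff by linarith
    qed
    have "c * \<mu> I \<le> c * 1" using c_pos Jm[OF j(1)] j N by (intro mult_left_mono) (auto simp: N_def)
    then show "c * \<mu> I \<le> \<mu> (I - A)" using c_le[OF j(1)] j by simp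
  qed simp
  have Cp: "0 < C" using C_ge by simp
  show ?thesis
  proof
    show "0 < c * exp (- (2 * M * C * \<rho>))" using c_pos by simp
    show "0 < \<rho>" by (rule \<rho>)
    fix n
    have rn: "0 \<le> \<rho> / \<sigma> ^ n" using \<rho> \<sigma>_gt_1 by simp
    have "2 * card V * C * (\<rho> - \<rho> / \<sigma> ^ n) \<le> 2 * card V * C * \<rho>"
      using rn Cp by (intro mult_left_mono) auto
    also have "\<dots> \<le> q" using N q by (simp add: \<rho>_def field_simps)
    finally have q': "2 * card V * C * (\<rho> - \<rho> / \<sigma> ^ n) \<le> q" .
    have "c * exp (- (2 * M * C * \<rho>)) \<le> c * exp (- (2 * M * C * (\<rho> - \<rho> / \<sigma> ^ n)))"
      using rn Cp M_nonneg c_pos by (auto intro!: mult_left_mono)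
    note c' = mult_right_mono[OF this, OF measure_nonneg]
    obtain \<J> where "complement_packing A (c * exp (- (2 * M * C * (\<rho> - \<rho> / \<sigma> ^ n)))) (\<rho> / \<sigma> ^ n)
           (2 * card V * C * (\<rho> - \<rho> / \<sigma> ^ n)) \<J>"
      using complement_packing_iterate[OF A inv good] c_pos \<rho> by (auto simp: less_imp_le)
    then have "complement_packing A (c * exp (- (2 * M * C * \<rho>))) (\<rho> / \<sigma> ^ n) q \<J>"
      using c' q' unfolding complement_packing_def by (meson order_trans diff_left_mono)
    then show "\<exists>\<J>. complement_packing A (c * exp (- (2 * M * C * \<rho>))) (\<rho> / \<sigma> ^ n) q \<J>" ..
  qed
qed

subsection \<open>Invariant sets of positive measure\<close>

text \<open>Otherwise there are arbitrarily fine packings in which the complement of \<open>A\<close> keeps the proportion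
\<open>c\<close> and which miss at most half the measure of \<open>A\<close>. Choose \<open>L \<subseteq> A \<subseteq> W\<close> with \<open>L\<close> compact, \<open>W\<close> open and both
differences of measure below \<open>e\<close>. Once the mesh is smaller than the distance from \<open>L\<close> to the
complement of \<open>W\<close>, the members that meet \<open>L\<close> lie in \<open>W\<close>, so the complement of \<open>A\<close> has measure at most \<open>e\<close>
in their union, although that union has measure at least \<open>\<mu> A / 2 - e\<close>.\<close>

proposition invariant_set_contains_open:
  assumes A: "A \<in> sets circle_measure"
    and inv: "AE x in circle_measure. x \<in> f -` A \<longleftrightarrow> x \<in> A"
    and A_pos: "0 < \<mu> A"
  obtains J where "open J" "J \<noteq> {}" "J \<subseteq> {0<..<1}" "\<mu> (J - A) = 0"
proof (rule ccontr)
  assume "\<not> thesis"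
  then have pos: "0 < \<mu> (J - A)" if "open J" "J \<noteq> {}" "J \<subseteq> {0<..<1}" for J
    using \<open>\<And>J. \<lbrakk>open J; J \<noteq> {}; J \<subseteq> {0<..<1}; \<mu> (J - A) = 0\<rbrakk> \<Longrightarrow> thesis\<close> that zero_less_measure_iff by blast
  have Ab: "A \<in> sets borel" "A \<subseteq> {0..<1}" using A by (auto simp: sets_circle_measure_iff)
  obtain c \<rho> where c: "0 < c" and \<rho>: "0 < \<rho>"
    and fam: "\<And>n. \<exists>\<J>. complement_packing A c (\<rho> / \<sigma> ^ n) (\<mu> A / 2) \<J>"
    using uniform_complement_packings[OF A inv pos, of "\<mu> A / 2"] A_pos by auto
  \<comment> \<open>any \<open>e\<close> with \<open>e * (1 + c) < c * \<mu> A / 2\<close> contradicts the estimate reached at the end\<close>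
  define e where "e = c * \<mu> A / (4 * (1 + c))"
  have e: "0 < e" using c A_pos by (simp add: e_def)
  have Al: "A \<in> sets lebesgue" using Ab by (simp add: sets_completionI_sets)
  obtain L where L: "closed L" "L \<subseteq> A" "emeasure lebesgue (A - L) < ennreal e"
    using Al e by (rule sets_lebesgue_inner_closed)
  obtain W where W: "open W" "A \<subseteq> W" "emeasure lebesgue (W - A) < ennreal e"
    using Al e by (rule sets_lebesgue_outer_open)
  have small: "\<mu> B \<le> e" if "B \<in> sets borel" "B \<subseteq> {0..<1}" "B \<subseteq> B'" "emeasure lebesgue B' < ennreal e"
    "B' \<in> sets borel" for B B'
  proof -
    have "emeasure circle_measure B = emeasure lebesgue B"
      using that by (simp add: emeasure_circle_measure)
    also have "\<dots> \<le> emeasure lebesgue B'" using that by (intro emeasure_mono) auto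
    also have "\<dots> \<le> ennreal e" using that by simp
    finally show ?thesis using e by (simp add: circle.emeasure_eq_measure)
  qed
  have Ls: "L \<in> sets circle_measure" using L Ab by (auto simp: sets_circle_measure_iff)
  have "\<mu> (A - L) \<le> e" using L Ab by (intro small[of _ "A - L"]) auto
  moreover have "\<mu> (A - L) = \<mu> A - \<mu> L" using A Ls L by (intro circle.finite_measure_Diff) auto
  ultimately have muL: "\<mu> A - e \<le> \<mu> L" by simp
  have "bounded L" using L Ab bounded_subset[of "{0..1::real}" L] by fastforce
  then have "compact L" using L by (simp add: compact_eq_bounded_closed)
  then obtain d where d: "0 < d" "(\<Union>x\<in>L. ball x d) \<subseteq> W"
    using compact_subset_open_imp_ball_epsilon_subset[of L W] L W by blast
  have "(\<lambda>n. \<rho> / \<sigma> ^ n) \<longlonglongrightarrow> 0"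
    using LIMSEQ_divide_realpow_zero[OF \<sigma>_gt_1] .
  then have "\<forall>\<^sub>F n in sequentially. \<rho> / \<sigma> ^ n < d" using d(1) by (rule order_tendstoD)
  then obtain n where n: "\<rho> / \<sigma> ^ n < d" by (auto simp: eventually_sequentially)
  obtain \<I> where "complement_packing A c (\<rho> / \<sigma> ^ n) (\<mu> A / 2) \<I>" using fam by blast
  then have fin: "finite \<I>" and dis: "disjoint \<I>" and tot: "1 - \<mu> A / 2 \<le> \<mu> (\<Union>\<I>)"
    and I: "\<And>I. I \<in> \<I> \<Longrightarrow> open I" "\<And>I. I \<in> \<I> \<Longrightarrow> I \<subseteq> {0..<1}"
      "\<And>I x y. I \<in> \<I> \<Longrightarrow> x \<in> I \<Longrightarrow> y \<in> I \<Longrightarrow> \<bar>x - y\<bar> \<le> \<rho> / \<sigma> ^ n"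
      "\<And>I. I \<in> \<I> \<Longrightarrow> c * \<mu> I \<le> \<mu> (I - A)"
    by (auto simp: complement_packing_def)
  have Is: "I \<in> sets circle_measure" if "I \<in> \<I>" for I
    using I(1,2)[OF that] by (simp add: sets_circle_measure_iff)
  define \<H> where "\<H> = {I\<in>\<I>. I \<inter> L \<noteq> {}}"
  have H: "finite \<H>" "\<H> \<subseteq> \<I>" using fin by (auto simp: \<H>_def)
  have Us: "\<Union>\<I> \<in> sets circle_measure" "\<Union>\<H> \<in> sets circle_measure"
    using fin H Is by (auto intro!: sets.finite_Union)
  have Hs: "(\<lambda>I. I) ` \<H> \<subseteq> sets circle_measure" "(\<lambda>I. I - A) ` \<H> \<subseteq> sets circle_measure"
    using H(2) Is A by auto
  have Hd: "disjoint_family_on (\<lambda>I. I) \<H>" "disjoint_family_on (\<lambda>I. I - A) \<H>"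
    using dis H(2) unfolding disjoint_family_on_def disjoint_def by blast+
  have HW: "\<Union>\<H> \<subseteq> W"
  proof
    fix x assume "x \<in> \<Union>\<H>"
    then obtain I0 y where "I0 \<in> \<I>" "x \<in> I0" "y \<in> I0" "y \<in> L" by (auto simp: \<H>_def)
    then have "\<bar>y - x\<bar> < d" using I(3)[of I0 y x] n by linarith
    then show "x \<in> W" using d \<open>y \<in> L\<close> by (force simp: dist_real_def)
  qed
  have "\<mu> A / 2 - e \<le> \<mu> (\<Union>\<H>)"
  proof -
    have "\<mu> L + \<mu> (\<Union>\<I> - L) = \<mu> (L \<union> (\<Union>\<I> - L))"
      using Ls Us by (intro circle.finite_measure_Union[symmetric]) auto
    also have "\<dots> \<le> \<mu> {0..<1}"
      using Ls Us by (intro circle.finite_measure_mono) (auto simp: sets_circle_measure_iff)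
    also have "\<dots> = 1" by (simp add: measure_circle_measure)
    finally have 1: "\<mu> L + \<mu> (\<Union>\<I> - L) \<le> 1" .
    have "\<mu> (\<Union>\<I>) \<le> \<mu> (\<Union>\<H> \<union> (\<Union>\<I> - L))"
      using Ls Us by (intro circle.finite_measure_mono) (auto simp: \<H>_def)
    also have "\<dots> \<le> \<mu> (\<Union>\<H>) + \<mu> (\<Union>\<I> - L)"
      using Ls Us by (intro measure_Un_le) auto
    finally show ?thesis using 1 tot muL by linarith
  qed
  then have "c * (\<mu> A / 2 - e) \<le> c * \<mu> (\<Union>\<H>)" using c by (intro mult_left_mono) auto
  also have "\<mu> (\<Union>\<H>) = (\<Sum>I\<in>\<H>. \<mu> I)"
    using circle.finite_measure_finite_Union[OF H(1) Hs(1) Hd(1)] by simp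
  also have "c * (\<Sum>I\<in>\<H>. \<mu> I) \<le> (\<Sum>I\<in>\<H>. \<mu> (I - A))"
    unfolding sum_distrib_left using I(4) H by (intro sum_mono) auto
  also have "\<dots> = \<mu> (\<Union>I\<in>\<H>. I - A)"
    using circle.finite_measure_finite_Union[OF H(1) Hs(2) Hd(2)] by (rule sym)
  also have "\<dots> \<le> e"
  proof (rule small)
    have "(\<Union>I\<in>\<H>. I - A) = \<Union>\<H> - A" by auto
    then show "(\<Union>I\<in>\<H>. I - A) \<in> sets borel" "(\<Union>I\<in>\<H>. I - A) \<subseteq> {0..<1}"
      "(\<Union>I\<in>\<H>. I - A) \<subseteq> W - A"
      using Us(2) Ab HW by (auto simp: sets_circle_measure_iff)
    show "W - A \<in> sets borel" using W(1) Ab by auto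
  qed (rule W)
  finally have "c * \<mu> A / 2 \<le> e * (1 + c)" by (simp add: algebra_simps)
  also have "\<dots> = c * \<mu> A / 4" using c by (simp add: e_def field_simps)
  finally show False using c A_pos by simp
qed

end

section \<open>Full branches of a piecewise smooth lifting\<close>

lemma lifting_diff_constant:
  assumes F: "lifting f F" and G: "lifting f G"
  obtains k :: int where "\<And>x. F x = G x + k"
proof -
  let ?d = "\<lambda>x. F x - G x"
  have Ints: "?d x \<in> \<int>" for x
  proof -
    have "frac (F x) = frac (G x)" using F G by (simp add: lifting_def)
    then have "?d x = of_int (\<lfloor>F x\<rfloor> - \<lfloor>G x\<rfloor>)" by (simp add: frac_def algebra_simps)
    then show ?thesis by (metis Ints_of_int)
  qed
  have "?d constant_on UNIV"
  proof (rule continuous_discrete_range_constant)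
    show "continuous_on UNIV ?d" using F G by (auto simp: lifting_def intro: continuous_on_diff)
    fix x
    have "1 \<le> norm (?d y - ?d x)" if "?d y \<noteq> ?d x" for y
      using Ints_nonzero_abs_ge1[of "?d y - ?d x"] Ints that by (simp only: Ints_diff real_norm_def)
    then show "\<exists>e>0. \<forall>y. y \<in> UNIV \<and> ?d y \<noteq> ?d x \<longrightarrow> e \<le> norm (?d y - ?d x)"
      by (intro exI[of _ 1]) auto
  qed simp
  then obtain c where c: "\<And>x. ?d x = c" by (auto simp: constant_on_def)
  obtain k where "c = of_int k" using Ints[of 0] c by (auto elim: Ints_cases)
  then have "F x = G x + k" for x using c[of x] by simp
  then show ?thesis by (rule that)
qed

lemma lifting_shift:
  assumes "lifting f F"
  shows "lifting f (\<lambda>x. F (x + of_int t))"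
proof -
  have F: "continuous_on UNIV F" "\<And>x. frac (F x) = f (frac x)" using assms by (simp_all add: lifting_def)
  have "continuous_on UNIV (\<lambda>x. F (x + of_int t))"
    by (rule continuous_on_compose2[OF F(1)]) (auto intro!: continuous_intros)
  moreover have "frac (x + of_int t) = frac x" for x :: real by (simp add: frac_def)
  ultimately show ?thesis by (simp add: lifting_def F(2))
qed

text \<open>A subinterval of the fundamental domain that contains no projected cut point lies, after an integer
translation, within a single arc: the one that contains the translated midpoint.\<close>

lemma arc_partition_shift:
  assumes a: "arc_partition n a" and uv: "0 \<le> u" "u < v" "v \<le> 1"
    and avoid: "{u<..<v} \<inter> frac ` a ` {..n} = {}"
  obtains t :: int and i where "i < n" "a i \<le> u + t" "v + t \<le> a (Suc i)"
proof -
  define m where "m = (u + v) / 2"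
  have m: "u < m" "m < v" using uv by (auto simp: m_def)
  define t where "t = \<lceil>a 0 - m\<rceil>"
  have t: "a 0 \<le> m + t" "m + t < a 0 + 1" unfolding t_def by linarith+
  obtain i where i: "i < n" "\<forall>j\<le>i. \<not> m + t < a j" "m + t < a (Suc i)"
    using ex_least_nat_less[of "\<lambda>j. m + t < a j" n] t a by (auto simp: arc_partition_def)
  have no: "\<not> (u < a j - t \<and> a j - t < v)" if "j \<le> n" for j
  proof
    assume *: "u < a j - t \<and> a j - t < v"
    then have "frac (a j) = a j - t" using uv by (simp add: frac_unique_iff)
    then have "a j - t \<in> frac ` a ` {..n}" using that by (metis atMost_iff imageI)
    then show False using * avoid by auto
  qed
  show ?thesis
  proof
    show "i < n" by (rule i)
    have "a i \<le> m + t" using i(2) by force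
    then show "a i \<le> u + t" using no[of i] i(1) m by linarith
    show "v + t \<le> a (Suc i)" using no[of "Suc i"] i(1,3) m by linarith
  qed
qed

definition gaps :: "real set \<Rightarrow> real set set" where
  "gaps D = {{a<..<b} | a b. a \<in> D \<and> b \<in> insert 1 D \<and> a < b \<and> {a<..<b} \<inter> D = {}}"

lemma finite_gaps: "finite D \<Longrightarrow> finite (gaps D)"
  by (rule finite_subset[of _ "(\<lambda>(a, b). {a<..<b}) ` (D \<times> insert 1 D)"]) (auto simp: gaps_def)

lemma disjoint_gaps:
  assumes D: "D \<subseteq> {0..<1}"
  shows "disjoint (gaps D)"
proof (rule disjointI)
  fix U W assume "U \<in> gaps D" "W \<in> gaps D" "U \<noteq> W"
  then obtain a b c d where U: "U = {a<..<b}" "a \<in> D" "b \<in> insert 1 D" "{a<..<b} \<inter> D = {}"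
    and W: "W = {c<..<d}" "c \<in> D" "d \<in> insert 1 D" "{c<..<d} \<inter> D = {}" by (auto simp: gaps_def)
  show "U \<inter> W = {}"
  proof (rule ccontr)
    assume "U \<inter> W \<noteq> {}"
    then obtain x where "x \<in> U" "x \<in> W" by blast
    then have x: "a < x" "x < b" "c < x" "x < d" using U(1) W(1) by simp_all
    have 1: "\<not> a < c" "\<not> c < a" using U W x by (auto simp: disjoint_iff)
    have "b \<le> 1" "d \<le> 1" using U W D by auto
    then have "\<not> b < d" "\<not> d < b" using U W x by (auto simp: disjoint_iff)
    then show False using 1 \<open>U \<noteq> W\<close> U W by auto
  qed
qed

lemma gaps_cover:
  assumes D: "finite D" "0 \<in> D" "D \<subseteq> {0..<1}"
  shows "{0..<1} - D \<subseteq> \<Union>(gaps D)"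
proof
  fix x assume x: "x \<in> {0..<1} - D"
  define L where "L = {d\<in>D. d < x}"
  define R where "R = {d\<in>insert 1 D. x < d}"
  have L: "finite L" "L \<noteq> {}" using D x by (auto simp: L_def order_less_le)
  have R: "finite R" "R \<noteq> {}" using D x by (auto simp: R_def)
  have "Max L \<in> L" "Min R \<in> R" using L R by simp_all
  then have LR: "Max L \<in> D" "Max L < x" "Min R \<in> insert 1 D" "x < Min R"
    by (auto simp only: L_def R_def mem_Collect_eq)
  have "{Max L<..<Min R} \<inter> D = {}"
  proof (rule ccontr)
    assume "{Max L<..<Min R} \<inter> D \<noteq> {}"
    then obtain d where d: "d \<in> D" "Max L < d" "d < Min R" by auto
    consider "d < x" | "x < d" using d x by (cases d x rule: linorder_cases) auto
    then show False
    proof cases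
      case 1 then have "d \<in> L" using d by (simp add: L_def)
      then show False using d L Max_ge leD by blast
    next
      case 2 then have "d \<in> R" using d by (simp add: R_def)
      then show False using d R Min_le leD by blast
    qed
  qed
  moreover have "Max L < Min R" using LR by linarith
  ultimately have "{Max L<..<Min R} \<in> gaps D"
    unfolding gaps_def using LR by blast
  moreover have "x \<in> {Max L<..<Min R}" using LR by simp
  ultimately show "x \<in> \<Union>(gaps D)" by blast
qed

lemma gapE:
  assumes "U \<in> gaps D" "D \<subseteq> {0..<1}"
  obtains u v where "U = {u<..<v}" "u \<in> D" "v \<in> insert 1 D" "0 \<le> u" "u < v" "v \<le> 1" "{u<..<v} \<inter> D = {}"
proof -
  obtain u v where uv: "U = {u<..<v}" "u \<in> D" "v \<in> insert 1 D" "u < v" "{u<..<v} \<inter> D = {}"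
    using assms(1) by (auto simp: gaps_def)
  have "0 \<le> u" "v \<le> 1" using uv(2,3) assms(2) by auto
  with uv show ?thesis by (intro that)
qed

text \<open>The continuous derivatives \<open>g'\<close> and \<open>g''\<close> are bounded on the closed interval, and the bound on \<open>g''\<close>
is a Lipschitz constant for \<open>g'\<close>; this is what controls the distortion.\<close>

lemma C2_on_derivative_bounds:
  assumes g: "C2_on {c..d} g"
  obtains g' K M where
    "\<And>x. x \<in> {c<..<d} \<Longrightarrow> (g has_real_derivative g' x) (at x)"
    "\<And>x. x \<in> {c<..<d} \<Longrightarrow> \<bar>g' x\<bar> \<le> K"
    "\<And>x y. x \<in> {c<..<d} \<Longrightarrow> y \<in> {c<..<d} \<Longrightarrow> \<bar>g' x - g' y\<bar> \<le> M * \<bar>x - y\<bar>"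
    "0 \<le> K" "0 \<le> M"
proof -
  obtain g' g'' where
    g1: "\<And>x. x \<in> {c..d} \<Longrightarrow> (g has_real_derivative g' x) (at x within {c..d})" and
    g2: "\<And>x. x \<in> {c..d} \<Longrightarrow> (g' has_real_derivative g'' x) (at x within {c..d})" and
    g3: "continuous_on {c..d} g''" using g unfolding C2_on_def by metis
  have bdd: "\<exists>K\<ge>0. \<forall>x\<in>{c..d}. \<bar>\<phi> x\<bar> \<le> K" if "continuous_on {c..d} \<phi>" for \<phi> :: "real \<Rightarrow> real"
  proof -
    have "bounded (\<phi> ` {c..d})"
      by (intro compact_imp_bounded compact_continuous_image that) simp
    then obtain K where "0 < K" "\<forall>y\<in>\<phi> ` {c..d}. norm y \<le> K" using bounded_pos by blast
    then show ?thesis by (intro exI[of _ K]) auto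
  qed
  have "continuous_on {c..d} g'" using g2 by (intro DERIV_continuous_on) auto
  from bdd[OF this] obtain K where K: "0 \<le> K" "\<And>x. x \<in> {c..d} \<Longrightarrow> \<bar>g' x\<bar> \<le> K" by auto
  from bdd[OF g3] obtain M where M: "0 \<le> M" "\<And>x. x \<in> {c..d} \<Longrightarrow> \<bar>g'' x\<bar> \<le> M" by auto
  show ?thesis
  proof
    show "(g has_real_derivative g' x) (at x)" if "x \<in> {c<..<d}" for x
      using g1[of x] that by (simp add: at_within_Icc_at)
    show "\<bar>g' x\<bar> \<le> K" if "x \<in> {c<..<d}" for x using K that by simp
    show "\<bar>g' x - g' y\<bar> \<le> M * \<bar>x - y\<bar>" if "x \<in> {c<..<d}" "y \<in> {c<..<d}" for x y
      using field_differentiable_bound[of "{c..d}" g' g'' M x y] g2 M(2) that by simp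
  qed (rule K M)+
qed

text \<open>The partition and the slope may refer to different liftings. Translating \<open>G\<close> by the integer of
\<open>arc_partition_shift\<close> gives another lifting of \<open>f\<close>, which differs from \<open>F\<close> by a constant.\<close>

lemma lifting_gap_regularity:
  assumes F: "lifting f F"
    and G: "lifting f G" "arc_partition n a"
      "\<forall>i<n. \<exists>g. C2_on {a i..a (Suc i)} g \<and> (\<forall>x\<in>{a i<..<a (Suc i)}. g x = G x)"
    and uv: "0 \<le> u" "u < v" "v \<le> 1" "{u<..<v} \<inter> frac ` a ` {..n} = {}"
  obtains h K M where
    "\<And>x. x \<in> {u<..<v} \<Longrightarrow> (F has_real_derivative h x) (at x)"
    "\<And>x. x \<in> {u<..<v} \<Longrightarrow> \<bar>h x\<bar> \<le> K"
    "\<And>x y. x \<in> {u<..<v} \<Longrightarrow> y \<in> {u<..<v} \<Longrightarrow> \<bar>h x - h y\<bar> \<le> M * \<bar>x - y\<bar>"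
    "0 \<le> K" "0 \<le> M"
proof -
  obtain t :: int and i where ti: "i < n" "a i \<le> u + t" "v + t \<le> a (Suc i)"
    using arc_partition_shift[OF G(2) uv] by blast
  obtain k :: int where k: "\<And>x. F x = G (x + t) + k"
    using lifting_diff_constant[OF F lifting_shift[OF G(1)]] by blast
  obtain g where g: "C2_on {a i..a (Suc i)} g" "\<And>x. x \<in> {a i<..<a (Suc i)} \<Longrightarrow> g x = G x"
    using G(3) ti(1) by blast
  obtain g' K M where g':
    "\<And>x. x \<in> {a i<..<a (Suc i)} \<Longrightarrow> (g has_real_derivative g' x) (at x)"
    "\<And>x. x \<in> {a i<..<a (Suc i)} \<Longrightarrow> \<bar>g' x\<bar> \<le> K"
    "\<And>x y. x \<in> {a i<..<a (Suc i)} \<Longrightarrow> y \<in> {a i<..<a (Suc i)} \<Longrightarrow> \<bar>g' x - g' y\<bar> \<le> M * \<bar>x - y\<bar>"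
    "0 \<le> K" "0 \<le> M" using C2_on_derivative_bounds[OF g(1)] by blast
  have mem: "x + t \<in> {a i<..<a (Suc i)}" if "x \<in> {u<..<v}" for x using that ti by simp
  show ?thesis
  proof
    fix x assume x: "x \<in> {u<..<v}"
    have "((\<lambda>x. g (x + t) + k) has_real_derivative g' (x + t)) (at x)"
      using g'(1)[OF mem[OF x]] by (auto simp: DERIV_shift intro!: derivative_eq_intros)
    then show "(F has_real_derivative g' (x + t)) (at x)"
      by (rule has_field_derivative_transform_within_open[of _ _ _ "{u<..<v}"])
         (use x g(2)[OF mem] k in auto)
    show "\<bar>g' (x + t)\<bar> \<le> K" by (rule g'(2)[OF mem[OF x]])
    show "\<bar>g' (x + t) - g' (y + t)\<bar> \<le> M * \<bar>x - y\<bar>" if "y \<in> {u<..<v}" for y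
      using g'(3)[OF mem[OF x] mem[OF that]] by simp
  qed (rule g')+
qed

lemma lifting_gap_slope:
  assumes F: "lifting f F"
    and slope: "\<forall>J. is_interval J \<and> inj_on frac J \<and> monotone_map_on J F \<longrightarrow>
      (\<forall>x\<in>J. \<forall>y\<in>J. x \<noteq> y \<longrightarrow> \<bar>(F x - F y) / (x - y)\<bar> > 1)"
    and G: "lifting f G" "arc_partition n a" "\<forall>i<n. monotone_map_on {a i..a (Suc i)} G"
    and uv: "0 \<le> u" "u < v" "v \<le> 1" "{u<..<v} \<inter> frac ` a ` {..n} = {}"
    and xy: "x \<in> {u<..<v}" "y \<in> {u<..<v}" "x \<noteq> y"
  shows "\<bar>x - y\<bar> < \<bar>F x - F y\<bar>"
proof -
  obtain t :: int and i where ti: "i < n" "a i \<le> u + t" "v + t \<le> a (Suc i)"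
    using arc_partition_shift[OF G(2) uv] by blast
  obtain k :: int where k: "\<And>x. F x = G (x + t) + k"
    using lifting_diff_constant[OF F lifting_shift[OF G(1)]] by blast
  have mem: "z + t \<in> {a i..a (Suc i)}" if "z \<in> {u<..<v}" for z using that ti by simp
  have "F z \<le> F w \<longleftrightarrow> G (z + t) \<le> G (w + t)" "z \<le> w \<longleftrightarrow> z + t \<le> w + t" for z w
    by (simp_all add: k)
  then have "monotone_map_on {u<..<v} F"
    using G(3)[rule_format, OF ti(1)] mem
    unfolding monotone_map_on_def monotone_on_def by blast
  moreover have "inj_on frac {u<..<v}"
    by (rule inj_on_inverseI[of _ id]) (use uv in \<open>auto simp: frac_eq\<close>)
  ultimately have "1 < \<bar>(F x - F y) / (x - y)\<bar>"
    using slope[rule_format, of "{u<..<v}" x y] xy is_interval_oo[of u v] by blast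
  then have "1 < \<bar>F x - F y\<bar> / \<bar>x - y\<bar>" by (simp only: abs_divide)
  then show ?thesis using xy by (simp add: pos_less_divide_eq)
qed

text \<open>The lifting is bounded on \<open>[0, 1]\<close>, so finitely many integer translates of \<open>V\<close> matter, and each of the
finitely many gaps contains at most one preimage of each.\<close>

lemma finite_circle_vimage:
  assumes F: "lifting f F" and D: "finite D" "0 \<in> D" "D \<subseteq> {0..<1}"
    and inj: "\<And>U. U \<in> gaps D \<Longrightarrow> inj_on F U"
    and V: "finite V"
  shows "finite {x\<in>{0..<1}. f x \<in> V}"
proof -
  have cont: "continuous_on UNIV F" and Ff: "\<And>x. frac (F x) = f (frac x)"
    using F by (auto simp: lifting_def)
  have "bounded (F ` {0..1})"
    by (intro compact_imp_bounded compact_continuous_image continuous_on_subset[OF cont]) auto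
  then obtain K where K: "\<forall>y\<in>F ` {0..1}. norm y \<le> K" using bounded_iff by blast
  define W where "W = (\<lambda>(v, m). v + of_int m) ` (V \<times> {- \<lceil>K\<rceil> - 1..\<lceil>K\<rceil>})"
  have W: "finite W" using V by (simp add: W_def)
  have FW: "F x \<in> W" if x: "0 \<le> x" "x < 1" "f x \<in> V" for x
  proof -
    have "frac x = x" using x by (simp add: frac_eq)
    then have "frac (F x) \<in> V" using x Ff[of x] by simp
    moreover have "\<bar>F x\<bar> \<le> K" using K x by force
    then have "\<lfloor>F x\<rfloor> \<in> {- \<lceil>K\<rceil> - 1..\<lceil>K\<rceil>}" by simp linarith
    moreover have "F x = frac (F x) + of_int \<lfloor>F x\<rfloor>" by (simp add: frac_def)
    ultimately show ?thesis unfolding W_def by (intro image_eqI[of _ _ "(frac (F x), \<lfloor>F x\<rfloor>)"]) auto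
  qed
  have "finite (U \<inter> F -` W)" if "U \<in> gaps D" for U
    using finite_vimage_IntI[OF W inj[OF that]] by (simp add: Int_commute)
  then have "finite (D \<union> (\<Union>U\<in>gaps D. U \<inter> F -` W))" using D(1) finite_gaps by blast
  moreover have "{x\<in>{0..<1}. f x \<in> V} \<subseteq> D \<union> (\<Union>U\<in>gaps D. U \<inter> F -` W)"
    using FW gaps_cover[OF D] by auto
  ultimately show ?thesis by (rule rev_finite_subset)
qed

text \<open>Avoiding the value \<open>0\<close> keeps the lifting away from the integers, so its integer part is constant.\<close>

lemma lifting_minus_int_on_gap:
  assumes F: "lifting f F" and uv: "0 \<le> u" "u < v" "v \<le> 1"
    and avoid: "\<And>x. x \<in> {u<..<v} \<Longrightarrow> f x \<noteq> 0"
  obtains m :: int where "\<And>x. x \<in> {u<..<v} \<Longrightarrow> f x = F x - m"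
proof -
  have cont: "continuous_on UNIV F" and Ff: "\<And>x. frac (F x) = f (frac x)"
    using F by (auto simp: lifting_def)
  have fF: "f x = frac (F x)" if "x \<in> {u<..<v}" for x
    using that uv Ff[of x] by (simp add: frac_eq[THEN iffD2])
  have nonint: "of_int k \<notin> F ` {u<..<v}" for k :: int
  proof
    assume "of_int k \<in> F ` {u<..<v}"
    then obtain x where "of_int k = F x" "x \<in> {u<..<v}" by (rule imageE)
    then show False using avoid[of x] fF[of x] by (metis frac_of_int)
  qed
  define x0 where "x0 = (u + v) / 2"
  have x0: "x0 \<in> {u<..<v}" using uv by (simp add: x0_def field_simps)
  define m where "m = \<lfloor>F x0\<rfloor>"
  have "connected (F ` {u<..<v})"
    by (intro connected_continuous_image continuous_on_subset[OF cont]) auto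
  then have int: "c \<in> F ` {u<..<v}" if "a \<in> F ` {u<..<v}" "b \<in> F ` {u<..<v}" "a \<le> c" "c \<le> b" for a b c
    using that unfolding is_interval_connected_1[symmetric] is_interval_1 by blast
  have "\<lfloor>F x\<rfloor> = m" if x: "x \<in> {u<..<v}" for x
  proof (rule floor_unique)
    have m: "of_int m \<le> F x0" "F x0 < of_int m + 1" by (simp_all add: m_def)
    show "of_int m \<le> F x"
    proof (rule ccontr)
      assume "\<not> of_int m \<le> F x"
      then have "of_int m \<in> F ` {u<..<v}" using int[of "F x" "F x0" m] x x0 m by auto
      then show False using nonint by blast
    qed
    show "F x < of_int m + 1"
    proof (rule ccontr)
      assume "\<not> F x < of_int m + 1"
      then have "of_int (m + 1) \<in> F ` {u<..<v}" using int[of "F x0" "F x" "of_int (m + 1)"] x x0 m by auto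
      then show False using nonint by blast
    qed
  qed
  then have "f x = F x - m" if "x \<in> {u<..<v}" for x using fF[OF that] that by (simp add: frac_def)
  then show ?thesis by (rule that)
qed

text \<open>The image of the gap is open, and adding the images of the two end points makes it closed. Those
images project into \<open>V\<close>, so \<open>I\<close> avoids them, and the image is open and closed relative to the
connected set \<open>I\<close>.\<close>

lemma gap_image_full:
  assumes F: "lifting f F" and uv: "u < v"
    and m: "\<And>x. x \<in> {u<..<v} \<Longrightarrow> f x = F x - of_int m"
    and inj: "inj_on f {u<..<v}"
    and ends: "f (frac u) \<in> V" "f (frac v) \<in> V"
    and I: "convex I" "I \<subseteq> {0..<1}" "I \<inter> V = {}" "I \<inter> f ` {u<..<v} \<noteq> {}"
  shows "I \<subseteq> f ` {u<..<v}"
proof -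
  have cont: "continuous_on UNIV F" and Ff: "\<And>x. frac (F x) = f (frac x)"
    using F by (auto simp: lifting_def)
  define G where "G x = F x - of_int m" for x
  have Gcont: "continuous_on S G" for S
    unfolding G_def by (intro continuous_intros continuous_on_subset[OF cont]) auto
  have fG: "f ` {u<..<v} = G ` {u<..<v}" using m by (auto simp: G_def)
  have "inj_on G {u<..<v}" using inj m by (simp add: inj_on_def G_def)
  then have 1: "open (f ` {u<..<v})" unfolding fG by (intro invariance_of_domain Gcont) auto
  have 2: "closed (G ` {u..v})" by (intro compact_imp_closed compact_continuous_image Gcont) auto
  have "G x \<notin> I" if "f (frac x) \<in> V" for x
  proof
    assume x: "G x \<in> I"
    then have "frac (G x) = G x" using I(2) by (auto simp: frac_eq)
    moreover have "frac (G x) = f (frac x)" using Ff[of x] by (simp add: G_def frac_def)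
    ultimately show False using that x I(3) by auto
  qed
  from this[OF ends(1)] this[OF ends(2)] have "G u \<notin> I" "G v \<notin> I" .
  moreover have "{u..v} = insert u (insert v {u<..<v})" using uv by auto
  ultimately have "I \<subseteq> f ` {u<..<v} \<union> - G ` {u..v}" by (auto simp: fG)
  moreover have "f ` {u<..<v} \<inter> - G ` {u..v} \<inter> I = {}" by (auto simp: fG)
  ultimately have "- G ` {u..v} \<inter> I = {}"
    using connectedD[OF convex_connected[OF I(1)] 1 open_Compl[OF 2]] I(4) by blast
  then show ?thesis using \<open>I \<subseteq> f ` {u<..<v} \<union> - G ` {u..v}\<close> by blast
qed

text \<open>Cut the circle at all cut points of both partitions and at \<open>0\<close>, which gives \<open>D0\<close>, and let \<open>V\<close> consist of
\<open>0\<close> and the values of \<open>f\<close> on \<open>D0\<close>. Cutting further, at the preimages of \<open>V\<close>, yields a set \<open>D\<close> whose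
values under \<open>f\<close> still lie in \<open>V\<close>, while \<open>f\<close> avoids \<open>V\<close> on the gaps of \<open>D\<close>: these gaps are the branches.
Having \<open>0\<close> in \<open>V\<close> ensures that \<open>f\<close> does not jump from \<open>1\<close> to \<open>0\<close> inside a branch.\<close>

theorem full_branch_structure:
  assumes f: "f \<in> C_lambda" "piecewise_C2 f" "slope_gt 1 f"
  obtains \<B> V C M where "full_branch_map f (deriv f) \<B> V C M"
proof -
  have pm: "piecewise_monotone f" using f(3) unfolding slope_gt_def by (rule conjunct1)
  have "\<exists>F. lifting f F \<and> (\<forall>J. is_interval J \<and> inj_on frac J \<and> monotone_map_on J F \<longrightarrow>
      (\<forall>x\<in>J. \<forall>y\<in>J. x \<noteq> y \<longrightarrow> \<bar>(F x - F y) / (x - y)\<bar> > 1))"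
    using f(3) unfolding slope_gt_def by (rule conjunct2)
  then obtain F where F: "lifting f F"
    and slope: "\<forall>J. is_interval J \<and> inj_on frac J \<and> monotone_map_on J F \<longrightarrow>
      (\<forall>x\<in>J. \<forall>y\<in>J. x \<noteq> y \<longrightarrow> \<bar>(F x - F y) / (x - y)\<bar> > 1)" by (elim exE conjE)
  obtain F1 n1 a1 where mono: "lifting f F1" "arc_partition n1 a1"
      "\<forall>i<n1. monotone_map_on {a1 i..a1 (Suc i)} F1"
    using pm unfolding piecewise_monotone_def by (elim exE conjE)
  obtain F2 n2 a2 where smooth: "lifting f F2" "arc_partition n2 a2"
      "\<forall>i<n2. \<exists>g. C2_on {a2 i..a2 (Suc i)} g \<and> (\<forall>x\<in>{a2 i<..<a2 (Suc i)}. g x = F2 x)"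
    using f(2) unfolding piecewise_C2_def by (elim exE conjE)
  have pres: "preserves circle_measure f" using f(1) by (simp add: C_lambda_def)
  have f_circle: "f x \<in> {0..<1}" if "x \<in> {0..<1}" for x
    using pres measurable_space[of f circle_measure circle_measure x] that
    by (simp add: preserves_def space_circle_measure)
  define D0 where "D0 = insert 0 (frac ` a1 ` {..n1} \<union> frac ` a2 ` {..n2})"
  have D0: "finite D0" "0 \<in> D0" "D0 \<subseteq> {0..<1}" by (auto simp: D0_def frac_lt_1)
  define V where "V = insert 0 (f ` D0)"
  have V: "finite V" "0 \<in> V" "V \<subseteq> {0..<1}" using D0 f_circle by (auto simp: V_def)
  have slope0: "\<bar>x - y\<bar> < \<bar>F x - F y\<bar>"
    if "0 \<le> u" "u < v" "v \<le> 1" "{u<..<v} \<inter> D0 = {}" "x \<in> {u<..<v}" "y \<in> {u<..<v}" "x \<noteq> y" for u v x y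
    using lifting_gap_slope[OF F slope mono that(1-3) _ that(5-7)] that(4) by (auto simp: D0_def)
  have "inj_on F U" if "U \<in> gaps D0" for U
    using that D0(3)
  proof (rule gapE)
    fix u v assume uv: "U = {u<..<v}" "0 \<le> u" "u < v" "v \<le> 1" "{u<..<v} \<inter> D0 = {}"
    show "inj_on F U"
    proof (rule inj_onI)
      fix x y assume "x \<in> U" "y \<in> U" "F x = F y"
      then show "x = y" using slope0[OF uv(2-5), of x y] uv(1) by (cases "x = y") auto
    qed
  qed
  then have fin: "finite {x\<in>{0..<1}. f x \<in> V}" by (rule finite_circle_vimage[OF F D0 _ V(1)])
  define D where "D = D0 \<union> {x\<in>{0..<1}. f x \<in> V}"
  have D: "finite D" "0 \<in> D" "D \<subseteq> {0..<1}" using D0 fin by (auto simp: D_def)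
  have fD: "f x \<in> V" if "x \<in> D" for x using that by (auto simp: D_def V_def)
  have avoid: "f x \<notin> V" if "U \<in> gaps D" "x \<in> U" for U x
    using that(1) D(3)
  proof (rule gapE)
    fix u v assume "U = {u<..<v}" "0 \<le> u" "v \<le> 1" "{u<..<v} \<inter> D = {}"
    then show "f x \<notin> V" using that(2) by (auto simp: D_def disjoint_iff)
  qed
  have branch: "\<exists>m::int. (\<forall>x\<in>U. f x = F x - m)" if U: "U \<in> gaps D" for U
    using U D(3)
  proof (rule gapE)
    fix u v assume uv: "U = {u<..<v}" "0 \<le> u" "u < v" "v \<le> 1"
    have "f x \<noteq> 0" if "x \<in> {u<..<v}" for x using avoid[OF U] that uv(1) V(2) by metis
    then show "\<exists>m::int. (\<forall>x\<in>U. f x = F x - m)"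
      using lifting_minus_int_on_gap[OF F uv(2-4)] uv(1) by metis
  qed
  have slope1: "\<bar>x - y\<bar> < \<bar>f x - f y\<bar>" if U: "U \<in> gaps D" and xy: "x \<in> U" "y \<in> U" "x \<noteq> y" for U x y
    using U D(3)
  proof (rule gapE)
    fix u v assume uv: "U = {u<..<v}" "0 \<le> u" "u < v" "v \<le> 1" "{u<..<v} \<inter> D = {}"
    have "{u<..<v} \<inter> D0 = {}" using uv(5) by (auto simp: D_def)
    from slope0[OF uv(2-4) this, of x y] show "\<bar>x - y\<bar> < \<bar>f x - f y\<bar>"
      using branch[OF U] xy uv(1) by auto
  qed
  have reg: "\<exists>K M. 0 \<le> K \<and> 0 \<le> M \<and> (\<forall>x\<in>U. (f has_real_derivative deriv f x) (at x) \<and> \<bar>deriv f x\<bar> \<le> K) \<and>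
      (\<forall>x\<in>U. \<forall>y\<in>U. \<bar>deriv f x - deriv f y\<bar> \<le> M * \<bar>x - y\<bar>)" if U: "U \<in> gaps D" for U
    using U D(3)
  proof (rule gapE)
    fix u v assume uv: "U = {u<..<v}" "0 \<le> u" "u < v" "v \<le> 1" "{u<..<v} \<inter> D = {}"
    have "{u<..<v} \<inter> frac ` a2 ` {..n2} = {}" using uv(5) by (auto simp: D_def D0_def)
    then obtain h K M where h: "\<And>x. x \<in> U \<Longrightarrow> (F has_real_derivative h x) (at x)"
      "\<And>x. x \<in> U \<Longrightarrow> \<bar>h x\<bar> \<le> K"
      "\<And>x y. x \<in> U \<Longrightarrow> y \<in> U \<Longrightarrow> \<bar>h x - h y\<bar> \<le> M * \<bar>x - y\<bar>" "0 \<le> K" "0 \<le> M"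
      using lifting_gap_regularity[OF F smooth uv(2-4)] uv(1) by metis
    obtain m :: int where m: "\<forall>x\<in>U. f x = F x - m" using branch[OF U] by blast
    have fh: "(f has_real_derivative h x) (at x)" if "x \<in> U" for x
    proof (rule has_field_derivative_transform_within_open[of _ _ _ U])
      show "((\<lambda>x. F x - m) has_real_derivative h x) (at x)"
        using h(1)[OF that] by (auto intro!: derivative_eq_intros)
    qed (use that uv(1) m in auto)
    then have "deriv f x = h x" if "x \<in> U" for x using that DERIV_imp_deriv by blast
    then show ?thesis using fh h by (intro exI[of _ K] exI[of _ M]) auto
  qed
  then obtain K M where "\<forall>U\<in>gaps D. 0 \<le> K U \<and> 0 \<le> M U \<and>
      (\<forall>x\<in>U. (f has_real_derivative deriv f x) (at x) \<and> \<bar>deriv f x\<bar> \<le> K U) \<and>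
      (\<forall>x\<in>U. \<forall>y\<in>U. \<bar>deriv f x - deriv f y\<bar> \<le> M U * \<bar>x - y\<bar>)"
    by metis
  then have KM: "\<And>U. U \<in> gaps D \<Longrightarrow> 0 \<le> K U" "\<And>U. U \<in> gaps D \<Longrightarrow> 0 \<le> M U"
    "\<And>U x. U \<in> gaps D \<Longrightarrow> x \<in> U \<Longrightarrow> (f has_real_derivative deriv f x) (at x)"
    "\<And>U x. U \<in> gaps D \<Longrightarrow> x \<in> U \<Longrightarrow> \<bar>deriv f x\<bar> \<le> K U"
    "\<And>U x y. U \<in> gaps D \<Longrightarrow> x \<in> U \<Longrightarrow> y \<in> U \<Longrightarrow> \<bar>deriv f x - deriv f y\<bar> \<le> M U * \<bar>x - y\<bar>"
    by blast+
  have fg: "finite (gaps D)" using D(1) by (rule finite_gaps)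
  have K_le: "K U \<le> (\<Sum>U\<in>gaps D. K U)" and M_le: "M U \<le> (\<Sum>U\<in>gaps D. M U)" if "U \<in> gaps D" for U
    using that fg KM(1,2) by (auto intro!: member_le_sum)
  \<comment> \<open>sums over the finitely many gaps serve as common bounds\<close>
  have "full_branch_map f (deriv f) (gaps D) V (2 + (\<Sum>U\<in>gaps D. K U)) (\<Sum>U\<in>gaps D. M U)"
  proof
    fix U assume U: "U \<in> gaps D"
    obtain u v where uv: "U = {u<..<v}" "u \<in> D" "v \<in> insert 1 D" "0 \<le> u" "u < v" "v \<le> 1"
      using U D(3) by (rule gapE)
    show "open U" "convex U" "U \<subseteq> {0..<1}" using uv by auto
    show "(f has_real_derivative deriv f x) (at x)" if "x \<in> U" for x using KM(3) U that .
    show "\<bar>deriv f x\<bar> \<le> 2 + (\<Sum>U\<in>gaps D. K U)" if "x \<in> U" for x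
      using KM(4)[OF U that] K_le[OF U] by simp
    show "\<bar>deriv f x - deriv f y\<bar> \<le> (\<Sum>U\<in>gaps D. M U) * \<bar>x - y\<bar>" if "x \<in> U" "y \<in> U" for x y
      using KM(5)[OF U that] mult_right_mono[OF M_le[OF U], of "\<bar>x - y\<bar>"] by simp
    show "\<bar>x - y\<bar> < \<bar>f x - f y\<bar>" if "x \<in> U" "y \<in> U" "x \<noteq> y" for x y
      using slope1 U that .
    show "f x \<notin> V" if "x \<in> U" for x using avoid U that .
    show "I \<subseteq> f ` U" if I: "convex I" "I \<subseteq> {0..<1}" "I \<inter> V = {}" "I \<inter> f ` U \<noteq> {}" for I
    proof -
      obtain m :: int where m: "\<forall>x\<in>U. f x = F x - m" using branch[OF U] by blast
      have "frac u \<in> D" using uv D(3) by (auto simp: frac_eq[THEN iffD2])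
      moreover have "frac v \<in> D" using uv(3) D by (auto simp: frac_eq[THEN iffD2])
      moreover have "inj_on f U"
      proof (rule inj_onI)
        fix x y assume "x \<in> U" "y \<in> U" "f x = f y"
        then show "x = y" using slope1[OF U, of x y] by (cases "x = y") auto
      qed
      ultimately show ?thesis
        using m I fD unfolding uv(1) by (intro gap_image_full[OF F uv(5), where m = m and V = V]) auto
    qed
  next
    have "{0..<1} - \<Union>(gaps D) \<subseteq> D" using gaps_cover[OF D] by auto
    then show "finite ({0..<1} - \<Union>(gaps D))" using D(1) by (rule finite_subset)
    show "disjoint (gaps D)" using D(3) by (rule disjoint_gaps)
    show "2 \<le> 2 + (\<Sum>U\<in>gaps D. K U)" "0 \<le> (\<Sum>U\<in>gaps D. M U)" using KM by (auto intro!: sum_nonneg)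
  qed (use pres fg V in auto)
  then show ?thesis by (rule that)
qed

section \<open>Measure-preserving maps and their iterates\<close>

lemma preserves_iterate:
  assumes "preserves M f"
  shows "preserves M (f ^^ n)"
proof (induction n)
  case 0
  then show ?case by (simp add: preserves_def sets.Int_space_eq2)
next
  case (Suc n)
  have f: "f \<in> measurable M M" and fn: "f ^^ n \<in> measurable M M"
    using assms Suc by (auto simp: preserves_def)
  have "emeasure M ((f ^^ Suc n) -` A \<inter> space M) = emeasure M A" if A: "A \<in> sets M" for A
  proof -
    have "(f ^^ Suc n) -` A \<inter> space M = (f ^^ n) -` (f -` A \<inter> space M) \<inter> space M"
      using measurable_space[OF fn] by auto
    also have "emeasure M \<dots> = emeasure M (f -` A \<inter> space M)"
      using Suc measurable_sets[OF f A] unfolding preserves_def by blast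
    also have "\<dots> = emeasure M A" using assms A unfolding preserves_def by blast
    finally show ?thesis .
  qed
  moreover have "f ^^ Suc n \<in> measurable M M"
    using measurable_comp[OF fn f] by (simp only: funpow.simps)
  ultimately show ?case unfolding preserves_def by blast
qed

lemma AE_preserves:
  assumes f: "preserves M f" and P: "AE x in M. P x"
  shows "AE x in M. P (f x)"
proof -
  obtain N where N: "N \<in> null_sets M" "{x \<in> space M. \<not> P x} \<subseteq> N"
    using P unfolding eventually_ae_filter by (elim bexE)
  have fm: "f \<in> measurable M M" using f by (simp add: preserves_def)
  have "f -` N \<inter> space M \<in> null_sets M"
    using N(1) f measurable_sets[OF fm] by (auto simp: preserves_def null_sets_def)
  moreover have "{x \<in> space M. \<not> P (f x)} \<subseteq> f -` N \<inter> space M"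
    using N(2) measurable_space[OF fm] by auto
  ultimately show ?thesis by (rule AE_I')
qed

lemma AE_invariant_iterate:
  assumes f: "preserves M f" and inv: "AE x in M. x \<in> f -` A \<longleftrightarrow> x \<in> A"
  shows "AE x in M. (f ^^ n) x \<in> A \<longleftrightarrow> x \<in> A"
proof (induction n)
  case 0 then show ?case by simp
next
  case (Suc n)
  from AE_preserves[OF preserves_iterate[OF f] inv, of n] Suc show ?case
    by eventually_elim simp
qed

section \<open>Transitivity and ergodicity\<close>

text \<open>The set \<open>W\<close> of points whose orbit meets \<open>V\<close> contains its own preimage, which has the same measure; so \<open>W\<close> is
invariant up to a null set, and not null because it contains \<open>V\<close>. By ergodicity it has full measure,
and therefore meets \<open>U\<close>.\<close>

lemma ergodic_imp_transitive:
  assumes f: "preserves circle_measure f" and erg: "ergodic circle_measure f"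
  shows "transitive circle f"
  unfolding transitive_def
proof (intro allI impI, elim conjE)
  fix U V assume U: "openin circle U" "U \<noteq> {}" and V: "openin circle V" "V \<noteq> {}"
  define W where "W = (\<Union>n. (f ^^ n) -` V \<inter> {0..<1})"
  have Vs: "V \<in> sets circle_measure"
    using V(1) by (auto simp: sets_circle_measure)
  have Ws: "W \<in> sets circle_measure"
  proof -
    have "(f ^^ n) -` V \<inter> {0..<1} \<in> sets circle_measure" for n
      using preserves_iterate[OF f, of n] measurable_sets[of "f ^^ n" circle_measure circle_measure V] Vs
      unfolding preserves_def space_circle_measure by blast
    then show ?thesis unfolding W_def by (intro sets.countable_UN) auto
  qed
  have f_sets: "f -` W \<inter> {0..<1} \<in> sets circle_measure"
    using measurable_sets[of f circle_measure circle_measure W] f Ws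
    by (simp add: preserves_def space_circle_measure)
  have fW: "f -` W \<inter> {0..<1} \<subseteq> W"
  proof
    fix x assume x: "x \<in> f -` W \<inter> {0..<1}"
    then obtain n where "(f ^^ n) (f x) \<in> V" by (auto simp: W_def)
    then have "(f ^^ Suc n) x \<in> V" by (simp add: funpow_swap1)
    then show "x \<in> W" using x unfolding W_def by blast
  qed
  have "measure circle_measure (W - (f -` W \<inter> {0..<1})) = 0"
    using circle.finite_measure_Diff[OF Ws f_sets fW] f Ws
    by (simp add: preserves_def measure_def space_circle_measure)
  then have "W - (f -` W \<inter> {0..<1}) \<in> null_sets circle_measure"
    using Ws f_sets by (simp add: circle.emeasure_eq_measure null_setsI sets.Diff)
  then have "AE x in circle_measure. x \<in> f -` W \<longleftrightarrow> x \<in> W"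
    by (rule AE_I') (use fW in \<open>auto simp: space_circle_measure\<close>)
  then have "emeasure circle_measure W = 0 \<or> emeasure circle_measure ({0..<1} - W) = 0"
    using erg Ws by (simp add: ergodic_def space_circle_measure)
  moreover have pos: "0 < emeasure circle_measure S" if "openin circle S'" "S' \<noteq> {}" "S' \<inter> {0<..<1} \<subseteq> S"
    "S \<in> sets circle_measure" for S S'
  proof -
    have "0 < measure circle_measure (S' \<inter> {0<..<1})"
      using openin_circle_interior[OF that(1,2)] by (intro circle_open_measure_pos) auto
    also have "\<dots> \<le> measure circle_measure S" by (rule circle.finite_measure_mono[OF that(3,4)])
    finally show ?thesis by (simp add: circle.emeasure_eq_measure)
  qed
  have "V \<subseteq> {0..<1}" using V(1) by (simp add: openin_circle)
  then have "V \<subseteq> W" unfolding W_def by (auto intro!: exI[of _ 0])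
  then have "0 < emeasure circle_measure W" using V Ws by (intro pos[of V]) auto
  ultimately have null: "emeasure circle_measure ({0..<1} - W) = 0" by auto
  have "U \<inter> W \<noteq> {}"
  proof
    assume "U \<inter> W = {}"
    then have "0 < emeasure circle_measure ({0..<1} - W)"
      using U Ws by (intro pos[of U]) (auto simp: sets_circle_measure_iff)
    then show False using null by simp
  qed
  then show "\<exists>n. (f ^^ n) ` U \<inter> V \<noteq> {}" unfolding W_def by blast
qed

text \<open>If neither \<open>A\<close> nor its complement is null, each contains a nonempty open set up to a null set, say \<open>J\<close>
and \<open>J'\<close>. The points of \<open>J\<close> that \<open>f ^^ n\<close> sends into \<open>J'\<close> form an open set \<open>E\<close>; almost every point of \<open>E\<close>
would lie in \<open>A\<close> while its \<open>n\<close>-th image lies outside, so \<open>E\<close> is null, hence empty. As this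
holds for every \<open>n\<close>, no iterate takes \<open>J\<close> to \<open>J'\<close>, against transitivity.\<close>

lemma (in full_branch_map) transitive_imp_ergodic:
  assumes cont: "continuous_map circle circle f" and trans: "transitive circle f"
  shows "ergodic circle_measure f"
  unfolding ergodic_def
proof (intro ballI impI, rule ccontr)
  fix A assume A: "A \<in> sets circle_measure" and inv: "AE x in circle_measure. x \<in> f -` A \<longleftrightarrow> x \<in> A"
    and neg: "\<not> (emeasure circle_measure A = 0 \<or> emeasure circle_measure (space circle_measure - A) = 0)"
  define A' where "A' = {0..<1} - A"
  have A': "A' \<in> sets circle_measure"
    using sets.compl_sets[OF A] by (simp add: A'_def space_circle_measure)
  have inv': "AE x in circle_measure. x \<in> f -` A' \<longleftrightarrow> x \<in> A'"
    using inv AE_space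
  proof eventually_elim
    case (elim x)
    then show ?case using f_circle[of x] by (auto simp: A'_def space_circle_measure)
  qed
  have "0 < \<mu> A" "0 < \<mu> A'"
    using neg by (auto simp: circle.emeasure_eq_measure zero_less_measure_iff A'_def space_circle_measure)
  obtain J where J: "open J" "J \<noteq> {}" "J \<subseteq> {0<..<1}" "\<mu> (J - A) = 0"
    using invariant_set_contains_open[OF A inv \<open>0 < \<mu> A\<close>] .
  obtain J' where J': "open J'" "J' \<noteq> {}" "J' \<subseteq> {0<..<1}" "\<mu> (J' - A') = 0"
    using invariant_set_contains_open[OF A' inv' \<open>0 < \<mu> A'\<close>] .
  have Js: "J \<in> sets circle_measure" "J' \<in> sets circle_measure"
    using J J' by (auto simp: sets_circle_measure_iff)
  have o: "openin circle J" "openin circle J'" using J J' by (auto intro: openin_circle_open)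
  obtain n where n: "(f ^^ n) ` J \<inter> J' \<noteq> {}"
    using trans o J(2) J'(2) unfolding transitive_def by blast
  define E where "E = J \<inter> ({x \<in> topspace circle. (f ^^ n) x \<in> J'})"
  have "continuous_map circle circle (f ^^ n)"
  proof (induction n)
    case 0
    show ?case by (simp only: funpow.simps continuous_map_id)
  next
    case (Suc n)
    then show ?case unfolding funpow.simps by (rule continuous_map_compose[OF _ cont])
  qed
  then have E: "openin circle E" unfolding E_def
    using o openin_continuous_map_preimage by blast
  have "E \<noteq> {}" using n J(3) by (force simp: E_def topspace_circle)
  have "E \<inter> {0<..<1} = E" using J(3) by (auto simp: E_def)
  then have "open E" using openin_circle_interior(1)[OF E \<open>E \<noteq> {}\<close>] by simp
  moreover have "E \<subseteq> {0..<1}" by (auto simp: E_def topspace_circle)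
  ultimately have "0 < \<mu> E" using \<open>E \<noteq> {}\<close> by (intro circle_open_measure_pos)
  have null: "AE x in circle_measure. x \<in> B \<longrightarrow> x \<in> S"
    if "\<mu> (B - S) = 0" "B \<in> sets circle_measure" "S \<in> sets circle_measure" for B S
  proof -
    have "B - S \<in> null_sets circle_measure"
      using that by (intro null_setsI) (auto simp: circle.emeasure_eq_measure)
    then show ?thesis by (rule AE_I') auto
  qed
  have "AE x in circle_measure. x \<notin> E"
    using null[OF J(4) Js(1) A] AE_preserves[OF preserves_iterate[OF preserving] null[OF J'(4) Js(2) A'], of n]
      AE_invariant_iterate[OF preserving inv, of n]
    by eventually_elim (auto simp: E_def A'_def)
  then have "\<mu> E = \<mu> {}"
    using E by (intro measure_eq_AE) (auto simp: sets_circle_measure)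
  then show False using \<open>0 < \<mu> E\<close> by simp
qed

theorem theorem3:
  fixes f :: "real \<Rightarrow> real"
  assumes "f \<in> C_lambda"
    and "piecewise_C2 f"
    and "slope_gt 1 f"
  shows "transitive circle f \<longleftrightarrow> ergodic circle_measure f"
proof
  obtain \<B> V C M where "full_branch_map f (deriv f) \<B> V C M"
    using full_branch_structure[OF assms] .
  then show "ergodic circle_measure f" if "transitive circle f"
    using full_branch_map.transitive_imp_ergodic that assms(1) by (simp add: C_lambda_def)
  show "transitive circle f" if "ergodic circle_measure f"
    using ergodic_imp_transitive that assms(1) by (simp add: C_lambda_def)
qed

end
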